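(* Let $\mathbb K$ be any field. (i) The Thompson group $V$ is isomorphic to the subgroup $\mathcal U_V/\mathbf I_V$ of the multiplicative part of the algebra $\mathcal C_V=\mathbb K[PC(a,b)]/\mathbf I_V$. (ii) The Thompson group $\mathcal G_{2,1}$ is isomorphic to the subgroup $\mathcal U_\infty/\mathbf I_\infty$ of the multiplicative part of the algebra $\mathcal C_\infty=\mathcal A_\infty/\mathbf I_\infty$. Here $\mathcal U_V/\mathbf I_V$ and $\mathcal U_\infty/\mathbf I_\infty$ denote the images of $\mathcal U_V$ and $\mathcal U_\infty$ in the respective quotient algebras.
   Context: Thompson groups. Let $A=\{a,b\}$ and $A^*$ the free monoid on $A$. A right ideal is a subset $R\subseteq A^*$ with $RA^*\subseteq R$; it is essential if it meets every (non-empty) right ideal. A prefix code is a set of words none of which is a strict prefix of another; it is maximal if not strictly contained in another prefix code. Every right ideal is $PA^*$ for a unique prefix code $P$; it is finitely generated iff $P$ is finite, essential iff $P$ is maximal. A right-ideal isomorphism is a bijection $\varphi:R_1\to R_2$ between right ideals with $\varphi(ux)=\varphi(u)x$ for $u\in R_1,x\in A^*$. Every isomorphism $\varphi$ between essential right ideals has a unique maximum extension $\mathsf{max}\,\varphi$ to a right-ideal isomorphism. $\mathcal G_{2,1}$ is the group of all maximal isomorphisms between essential right ideals of $\{a,b\}^*$, and $V$ is the group of all maximal isomorphisms between finitely generated essential right ideals of $\{a,b\}^*$; the multiplication is $\varphi\cdot\psi=\mathsf{max}(\varphi\circ\psi)$. Polycyclic monoid. $PC(a,b)$ is the inverse monoid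 with zero $\mathbf 0$ generated by $a,b$ with relations $a^{-1}a=b^{-1}b=\mathbf 1$, $a^{-1}b=b^{-1}a=\mathbf 0$. Its non-zero elements are $yx^{-1}$ with $x,y\in A^*$; for $u,v\in A^*$: $u^{-1}v=z$ if $v=uz$, $u^{-1}v=w^{-1}$ if $u=vw$, and $u^{-1}v=\mathbf 0$ if neither of $u,v$ is a prefix of the other. Algebras. $\mathbb K[PC(a,b)]$ is the algebra of finite $\mathbb K$-linear combinations of elements of $PC(a,b)$, the zero of the monoid being identified with the zero of the algebra. $\langle\langle X\rangle\rangle$ denotes the (two-sided) ideal generated by $X$. $\mathbf I_V=\langle\langle aa^{-1}+bb^{-1}-\mathbf 1\rangle\rangle\subset\mathbb K[PC(a,b)]$. A relation $S\subset A^*\times A^*$ is finite-to-finite if each $x$ is related to only finitely many $y$, and each $y$ to only finitely many $x$. $\mathcal B_\infty$ is the algebra of all (possibly infinite) formal sums $\sum_{i\in I}\kappa_i\,y_ix_i^{-1}$ with $I\subseteq\mathbb N$, $\kappa_i\in\mathbb K$, $y_ix_i^{-1}\in PC(a,b)$ such that $\{(y_i,x_i):i\in I\}$ is finite-to-finite, together with $\mathbf 0$; multiplication is the distributive extension of that of $PC(a,b)$ (each coefficient of a product is a finite sum). $\mathcal U_\infty^{\rm part}\subset\mathcal B_\infty$ is the set of sums $\sum_{i\in I}y_ix_i^{-1}$ with all coefficients equal to $1$ such that $\{x_i:i\in I\}$ and $\{y_i:i\in I\}$ are prefix codes and $i\mapsto x_i$, $i\mapsto y_i$ are bijections from $I$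 onto these codes. $\mathcal U_\infty$ is the subset of those sums for which both prefix codes are maximal, and $\mathcal U_V$ is the subset of $\mathcal U_\infty$ of those with $I$ finite (so $\mathcal U_V\subset\mathbb K[PC(a,b)]$). These sets are closed under multiplication. $\mathcal A_\infty$ is the subalgebra of $\mathcal B_\infty$ generated by $\mathcal U_\infty^{\rm part}$. $\mathbf I_\infty$ is the ideal of $\mathcal A_\infty$ generated by all elements $\sum_{i\in I}y_i\big(\sum_{q\in Q_i}q\,q^{-1}-\mathbf 1\big)x_i^{-1}$, where $I\subseteq\mathbb N$, $\{x_i:i\in I\}$ and $\{y_i:i\in I\}$ are maximal prefix codes bijectively indexed by $I$, and each $Q_i$ is a maximal prefix code of $A^*$. *)

theory Defs
  imports "HOL-Algebra.QuotRing" "HOL-Algebra.Subrings" "HOL-Library.Sublist"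
begin

section \<open>Words, right ideals and prefix codes\<close>

datatype letter = LetA | LetB

type_synonym word = "letter list"

definition right_ideal :: "word set \<Rightarrow> bool" where
  "right_ideal R \<longleftrightarrow> (\<forall>u\<in>R. \<forall>x. u @ x \<in> R)"

definition essential :: "word set \<Rightarrow> bool" where
  "essential R \<longleftrightarrow> right_ideal R \<and> (\<forall>S. right_ideal S \<and> S \<noteq> {} \<longrightarrow> R \<inter> S \<noteq> {})"

definition fin_gen :: "word set \<Rightarrow> bool" where
  "fin_gen R \<longleftrightarrow> (\<exists>F. finite F \<and> R = {u @ x | u x. u \<in> F})"

definition prefix_code :: "word set \<Rightarrow> bool" where
  "prefix_code P \<longleftrightarrow> (\<forall>u\<in>P. \<forall>v\<in>P. \<not> strict_prefix u v)"

definition maximal_prefix_code :: "word set \<Rightarrow> bool" where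
  "maximal_prefix_code P \<longleftrightarrow> prefix_code P \<and> (\<nexists>Q. prefix_code Q \<and> P \<subset> Q)"


section \<open>The Thompson groups\<close>

text \<open>A right-ideal isomorphism \<open>R\<^sub>1 \<rightarrow> R\<^sub>2\<close> is encoded as a partial function on words with
  domain \<open>R\<^sub>1\<close> and range \<open>R\<^sub>2\<close>; the map order \<open>\<subseteq>\<^sub>m\<close> is then extension.\<close>

definition right_ideal_iso :: "(word \<rightharpoonup> word) \<Rightarrow> bool" where
  "right_ideal_iso \<phi> \<longleftrightarrow>
     right_ideal (dom \<phi>) \<and> right_ideal (ran \<phi>) \<and> inj_on \<phi> (dom \<phi>) \<and>
     (\<forall>u v x. \<phi> u = Some v \<longrightarrow> \<phi> (u @ x) = Some (v @ x))"

definition maximal_iso :: "(word \<rightharpoonup> word) \<Rightarrow> bool" where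
  "maximal_iso \<phi> \<longleftrightarrow> right_ideal_iso \<phi> \<and> (\<forall>\<psi>. right_ideal_iso \<psi> \<and> \<phi> \<subseteq>\<^sub>m \<psi> \<longrightarrow> \<psi> = \<phi>)"

definition is_max_extension :: "(word \<rightharpoonup> word) \<Rightarrow> (word \<rightharpoonup> word) \<Rightarrow> bool" where
  "is_max_extension \<phi> \<psi> \<longleftrightarrow> right_ideal_iso \<psi> \<and> \<phi> \<subseteq>\<^sub>m \<psi> \<and>
     (\<forall>\<chi>. right_ideal_iso \<chi> \<and> \<phi> \<subseteq>\<^sub>m \<chi> \<longrightarrow> \<chi> \<subseteq>\<^sub>m \<psi>)"

definition max_extension :: "(word \<rightharpoonup> word) \<Rightarrow> (word \<rightharpoonup> word)" where
  "max_extension \<phi> = (THE \<psi>. is_max_extension \<phi> \<psi>)"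

definition thompson_G21 :: "(word \<rightharpoonup> word) monoid" where
  "thompson_G21 =
     \<lparr>carrier = {\<phi>. maximal_iso \<phi> \<and> essential (dom \<phi>) \<and> essential (ran \<phi>)},
      mult = (\<lambda>\<phi> \<psi>. max_extension (\<phi> \<circ>\<^sub>m \<psi>)),
      one = Some\<rparr>"

definition thompson_V :: "(word \<rightharpoonup> word) monoid" where
  "thompson_V =
     \<lparr>carrier = {\<phi>. maximal_iso \<phi> \<and> essential (dom \<phi>) \<and> essential (ran \<phi>) \<and>
                     fin_gen (dom \<phi>) \<and> fin_gen (ran \<phi>)},
      mult = (\<lambda>\<phi> \<psi>. max_extension (\<phi> \<circ>\<^sub>m \<psi>)),
      one = Some\<rparr>"

text \<open>Existence and uniqueness of the maximum extension, which is the union of all extensions.\<close>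

lemma right_ideal_isoD:
  assumes "right_ideal_iso \<phi>"
  shows "\<phi> u = Some v \<Longrightarrow> \<phi> (u @ x) = Some (v @ x)"
    and "\<phi> u = Some v \<Longrightarrow> \<phi> u' = Some v \<Longrightarrow> u = u'"
  using assms unfolding right_ideal_iso_def inj_on_def by (auto simp: dom_def)

lemma essential_meets:
  assumes "essential R"
  shows "\<exists>z. w @ z \<in> R"
proof -
  have "right_ideal {w @ z | z. True}" "{w @ z | z. True} \<noteq> {}"
    by (auto simp: right_ideal_def)
  with assms have "R \<inter> {w @ z | z. True} \<noteq> {}" unfolding essential_def by blast
  then show ?thesis by auto
qed

lemma extensions_compatible:
  assumes ess: "essential (dom \<phi>)" "essential (ran \<phi>)"
    and 1: "right_ideal_iso \<psi>1" "\<phi> \<subseteq>\<^sub>m \<psi>1" and 2: "right_ideal_iso \<psi>2" "\<phi> \<subseteq>\<^sub>m \<psi>2"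
  shows "\<psi>1 u = Some v1 \<Longrightarrow> \<psi>2 u = Some v2 \<Longrightarrow> v1 = v2"
    and "\<psi>1 u1 = Some w \<Longrightarrow> \<psi>2 u2 = Some w \<Longrightarrow> u1 = u2"
proof -
  have ext: "\<psi>1 t = Some s" "\<psi>2 t = Some s" if "\<phi> t = Some s" for t s
    using 1(2) 2(2) that unfolding map_le_def by (metis domI)+
  { assume a: "\<psi>1 u = Some v1" "\<psi>2 u = Some v2"
    obtain z s where "\<phi> (u @ z) = Some s" using essential_meets[OF ess(1), of u] by auto
    from ext[OF this] right_ideal_isoD(1)[OF 1(1) a(1), of z]
      right_ideal_isoD(1)[OF 2(1) a(2), of z]
    show "v1 = v2" by auto }
  { assume a: "\<psi>1 u1 = Some w" "\<psi>2 u2 = Some w"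
    obtain z t where t: "\<phi> t = Some (w @ z)"
      using essential_meets[OF ess(2), of w] by (auto simp: ran_def)
    have "u1 @ z = t" "u2 @ z = t"
      using ext[OF t] right_ideal_isoD(1)[OF 1(1) a(1), of z]
        right_ideal_isoD(1)[OF 2(1) a(2), of z]
        right_ideal_isoD(2)[OF 1(1)] right_ideal_isoD(2)[OF 2(1)] by blast+
    then show "u1 = u2" by auto }
qed

lemma ex1_max_extension:
  assumes iso: "right_ideal_iso \<phi>" and ess: "essential (dom \<phi>)" "essential (ran \<phi>)"
  shows "\<exists>!\<psi>. is_max_extension \<phi> \<psi>"
proof
  define E where "E = {\<chi>. right_ideal_iso \<chi> \<and> \<phi> \<subseteq>\<^sub>m \<chi>}"
  define M where "M u = (if \<exists>\<chi>\<in>E. \<chi> u \<noteq> None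
    then Some (SOME v. \<exists>\<chi>\<in>E. \<chi> u = Some v) else None)" for u
  have M: "M u = Some v \<longleftrightarrow> (\<exists>\<chi>\<in>E. \<chi> u = Some v)" for u v
  proof -
    have "(SOME v. \<exists>\<chi>\<in>E. \<chi> u = Some v) = v" if "\<exists>\<chi>\<in>E. \<chi> u = Some v" for v
      using that extensions_compatible(1)[OF ess, of _ _ u] unfolding E_def by blast
    moreover have "\<exists>\<chi>\<in>E. \<chi> u = Some (SOME v. \<exists>\<chi>\<in>E. \<chi> u = Some v)"
      if "\<exists>\<chi>\<in>E. \<chi> u \<noteq> None"
      using that by (intro someI_ex[of "\<lambda>v. \<exists>\<chi>\<in>E. \<chi> u = Some v"]) auto
    ultimately show ?thesis unfolding M_def by (auto split: if_splits)
  qed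
  have comm: "M (u @ x) = Some (v @ x)" if "M u = Some v" for u v x
    using that right_ideal_isoD(1) unfolding M E_def by blast
  have "right_ideal (dom M)" "right_ideal (ran M)"
    using comm unfolding right_ideal_def dom_def ran_def by blast+
  moreover have "inj_on M (dom M)"
    using extensions_compatible(2)[OF ess] unfolding inj_on_def dom_def E_def
    by (auto simp: M E_def) (metis (mono_tags, lifting) E_def M mem_Collect_eq)
  ultimately have "right_ideal_iso M" using comm unfolding right_ideal_iso_def by blast
  moreover have "\<chi> \<subseteq>\<^sub>m M" if "\<chi> \<in> E" for \<chi>
    using that M unfolding map_le_def by (metis domD)
  moreover have "\<phi> \<in> E" using iso by (simp add: E_def)
  ultimately show "is_max_extension \<phi> M" unfolding is_max_extension_def E_def by blast
  fix \<psi> assume "is_max_extension \<phi> \<psi>"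
  with \<open>is_max_extension \<phi> M\<close> show "\<psi> = M"
    unfolding is_max_extension_def by (meson map_le_antisym)
qed


section \<open>The polycyclic monoid\<close>

text \<open>\<open>PC y x\<close> is the normal form \<open>y x\<inverse>\<close>. The function \<open>inv_word_mult u v\<close> computes
  \<open>u\<inverse> v\<close>, and \<open>(y\<^sub>1 x\<^sub>1\<inverse>) (y\<^sub>2 x\<^sub>2\<inverse>) = y\<^sub>1 (x\<^sub>1\<inverse> y\<^sub>2) x\<^sub>2\<inverse>\<close>.\<close>

datatype pc = PCZero | PC word word

definition inv_word_mult :: "word \<Rightarrow> word \<Rightarrow> pc" where
  "inv_word_mult u v =
     (if prefix u v then PC (drop (length u) v) []
      else if prefix v u then PC [] (drop (length v) u)
      else PCZero)"

fun pc_mult :: "pc \<Rightarrow> pc \<Rightarrow> pc" where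
  "pc_mult PCZero t = PCZero"
| "pc_mult (PC y x) PCZero = PCZero"
| "pc_mult (PC y1 x1) (PC y2 x2) =
     (case inv_word_mult x1 y2 of PCZero \<Rightarrow> PCZero | PC z w \<Rightarrow> PC (y1 @ z) (x2 @ w))"

fun pc_inv :: "pc \<Rightarrow> pc" where
  "pc_inv PCZero = PCZero"
| "pc_inv (PC y x) = PC x y"

definition pc_of_word :: "word \<Rightarrow> pc" where
  "pc_of_word w = PC w []"

definition polycyclic_monoid :: "pc monoid" where
  "polycyclic_monoid = \<lparr>carrier = UNIV, mult = pc_mult, one = PC [] []\<rparr>"

text \<open>The multiplication above does yield an inverse monoid with zero satisfying the defining
  relations of \<open>PC(a,b)\<close> and generated by the letters and their inverses.\<close>

fun pc_act :: "pc \<Rightarrow> word \<rightharpoonup> word" where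
  "pc_act PCZero u = None"
| "pc_act (PC y x) u = (if prefix x u then Some (y @ drop (length x) u) else None)"

lemma pc_act_mult: "pc_act (pc_mult p q) = pc_act p \<circ>\<^sub>m pc_act q"
proof
  fix u
  show "pc_act (pc_mult p q) u = (pc_act p \<circ>\<^sub>m pc_act q) u"
  proof (cases p; cases q)
    fix y1 x1 y2 x2 assume pq: "p = PC y1 x1" "q = PC y2 x2"
    consider z where "y2 = x1 @ z" | z where "x1 = y2 @ z" "z \<noteq> []" | "x1 \<parallel> y2"
      unfolding parallel_def prefix_def by (metis append_Nil2)
    then show ?thesis
    proof cases
      case 1 then show ?thesis
        by (auto simp: pq map_comp_def inv_word_mult_def prefix_def)
    next
      case 2 then show ?thesis
        by (auto simp: pq map_comp_def inv_word_mult_def prefix_def)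
    next
      case 3 
      then have "\<not> prefix x1 (y2 @ w)" for w
        by (metis parallel_def prefix_def prefix_same_cases)
      with 3 show ?thesis by (auto simp: pq map_comp_def inv_word_mult_def parallel_def)
    qed
  qed (auto simp: map_comp_def split: option.splits)
qed

lemma pc_act_inject: "pc_act p = pc_act q \<Longrightarrow> p = q"
proof (cases p; cases q)
  fix y1 x1 y2 x2 assume e: "pc_act p = pc_act q" and pq: "p = PC y1 x1" "q = PC y2 x2"
  from fun_cong[OF e, of x1] fun_cong[OF e, of x2]
  have "prefix x1 x2" "prefix x2 x1" by (auto simp: pq split: if_splits)
  then have x: "x1 = x2" by (rule prefix_order.antisym)
  from fun_cong[OF e, of x1] show "p = q" by (simp add: pq x)
next
  fix y x assume "pc_act p = pc_act q" "p = PC y x" "q = PCZero"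
  then show "p = q" by (auto dest: fun_cong[of _ _ x])
next
  fix y x assume "pc_act p = pc_act q" "q = PC y x" "p = PCZero"
  then show "p = q" by (auto dest: fun_cong[of _ _ x])
qed simp

lemma pc_mult_assoc: "pc_mult (pc_mult p q) r = pc_mult p (pc_mult q r)"
  by (rule pc_act_inject) (auto simp: pc_act_mult map_comp_def fun_eq_iff split: option.splits)

lemma monoid_polycyclic: "monoid polycyclic_monoid"
proof (rule monoidI, goal_cases)
  case (4 p) then show ?case by (cases p) (auto simp: polycyclic_monoid_def inv_word_mult_def)
next
  case (5 p) then show ?case
    by (cases p) (auto simp: polycyclic_monoid_def inv_word_mult_def split: list.splits)
qed (auto simp: polycyclic_monoid_def pc_mult_assoc)

lemma pc_inverse: "pc_mult (pc_mult p (pc_inv p)) p = p"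
  by (cases p) (auto simp: inv_word_mult_def)

lemma pc_idempotents_commute:
  assumes "pc_mult p p = p" "pc_mult q q = q"
  shows "pc_mult p q = pc_mult q p"
proof -
  have *: "\<exists>x. r = PC x x" if "pc_mult r r = r" "r \<noteq> PCZero" for r
    using that by (cases r) (auto simp: inv_word_mult_def prefix_def split: if_splits)
  show ?thesis
  proof (cases "p = PCZero \<or> q = PCZero")
    case True then show ?thesis by (cases p; cases q) auto
  next
    case False
    then obtain u v where uv: "p = PC u u" "q = PC v v" using * assms by blast
    show ?thesis by (auto simp: uv inv_word_mult_def prefix_def)
  qed
qed

lemma pc_relations:
  "pc_mult (pc_inv (pc_of_word [LetA])) (pc_of_word [LetA]) = PC [] []"
  "pc_mult (pc_inv (pc_of_word [LetB])) (pc_of_word [LetB]) = PC [] []"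
  "pc_mult (pc_inv (pc_of_word [LetA])) (pc_of_word [LetB]) = PCZero"
  "pc_mult (pc_inv (pc_of_word [LetB])) (pc_of_word [LetA]) = PCZero"
  by (simp_all add: pc_of_word_def inv_word_mult_def)

lemma pc_normal_form: "PC y x = pc_mult (pc_of_word y) (pc_inv (pc_of_word x))"
  by (simp add: pc_of_word_def inv_word_mult_def)

lemma pc_of_word_append: "pc_of_word (u @ v) = pc_mult (pc_of_word u) (pc_of_word v)"
  by (simp add: pc_of_word_def inv_word_mult_def)


section \<open>The algebras\<close>

text \<open>An element of \<open>K[PC(a,b)]\<close> or of \<open>B\<^sub>\<infinity>\<close> is represented by its coefficient function
  \<open>pc \<Rightarrow> 'k\<close>. Identifying the zero of the monoid with the zero of the algebra means that the
  coefficient at \<open>PCZero\<close> is always \<open>0\<close>. The sum in \<open>pc_conv\<close> is finite on the carriers below.\<close>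

definition pc_conv :: "(pc \<Rightarrow> 'k::field) \<Rightarrow> (pc \<Rightarrow> 'k) \<Rightarrow> pc \<Rightarrow> 'k" where
  "pc_conv f g p =
     (if p = PCZero then 0
      else \<Sum>(s, t) \<in> {(s, t). f s \<noteq> 0 \<and> g t \<noteq> 0 \<and> pc_mult s t = p}. f s * g t)"

definition pc_single :: "pc \<Rightarrow> pc \<Rightarrow> 'k::field" where
  "pc_single s p = (if p = s \<and> p \<noteq> PCZero then 1 else 0)"

definition pc_scale :: "'k::field \<Rightarrow> (pc \<Rightarrow> 'k) \<Rightarrow> pc \<Rightarrow> 'k" where
  "pc_scale c f = (\<lambda>p. c * f p)"

text \<open>Coefficientwise sum of a possibly infinite family; meaningful when every \<open>p\<close> has a nonzero
  coefficient in only finitely many members of the family.\<close>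

definition formal_sum :: "'i set \<Rightarrow> ('i \<Rightarrow> pc \<Rightarrow> 'k::field) \<Rightarrow> pc \<Rightarrow> 'k" where
  "formal_sum I g p = (\<Sum>i\<in>{i \<in> I. g i p \<noteq> 0}. g i p)"

definition finite_to_finite :: "('a \<times> 'b) set \<Rightarrow> bool" where
  "finite_to_finite S \<longleftrightarrow> (\<forall>x. finite {y. (x, y) \<in> S}) \<and> (\<forall>y. finite {x. (x, y) \<in> S})"

definition pc_algebra :: "(pc \<Rightarrow> 'k::field) ring" where
  "pc_algebra =
     \<lparr>carrier = {f. f PCZero = 0 \<and> finite {p. f p \<noteq> 0}},
      mult = pc_conv, one = pc_single (PC [] []),
      zero = (\<lambda>p. 0), add = (\<lambda>f g p. f p + g p)\<rparr>"

definition B_infty :: "(pc \<Rightarrow> 'k::field) ring" where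
  "B_infty =
     \<lparr>carrier = {f. f PCZero = 0 \<and> finite_to_finite {(y, x). f (PC y x) \<noteq> 0}},
      mult = pc_conv, one = pc_single (PC [] []),
      zero = (\<lambda>p. 0), add = (\<lambda>f g p. f p + g p)\<rparr>"

lemma pc_conv_single:
  "pc_conv (pc_single s) (pc_single t) = (pc_single (pc_mult s t) :: pc \<Rightarrow> 'k::field)"
proof
  fix p
  have *: "{(s', t'). pc_single s s' \<noteq> (0::'k) \<and> pc_single t t' \<noteq> (0::'k) \<and> pc_mult s' t' = p} =
      (if s \<noteq> PCZero \<and> t \<noteq> PCZero \<and> pc_mult s t = p then {(s, t)} else {})"
    by (auto simp: pc_single_def)
  show "pc_conv (pc_single s) (pc_single t) p = (pc_single (pc_mult s t) p :: 'k)"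
    unfolding pc_conv_def * by (cases s; cases t) (auto simp: pc_single_def)
qed

definition U_infty_part :: "(pc \<Rightarrow> 'k::field) set" where
  "U_infty_part = {formal_sum I (\<lambda>i. pc_single (PC (y i) (x i))) | (I :: nat set) y x.
     inj_on x I \<and> inj_on y I \<and> prefix_code (x ` I) \<and> prefix_code (y ` I)}"

definition U_infty :: "(pc \<Rightarrow> 'k::field) set" where
  "U_infty = {formal_sum I (\<lambda>i. pc_single (PC (y i) (x i))) | (I :: nat set) y x.
     inj_on x I \<and> inj_on y I \<and> maximal_prefix_code (x ` I) \<and> maximal_prefix_code (y ` I)}"

definition U_V :: "(pc \<Rightarrow> 'k::field) set" where
  "U_V = {formal_sum I (\<lambda>i. pc_single (PC (y i) (x i))) | (I :: nat set) y x. finite I \<and>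
     inj_on x I \<and> inj_on y I \<and> maximal_prefix_code (x ` I) \<and> maximal_prefix_code (y ` I)}"

definition A_infty :: "(pc \<Rightarrow> 'k::field) ring" where
  "A_infty = B_infty\<lparr>carrier :=
     \<Inter>{S. subring S B_infty \<and> (\<forall>c. \<forall>f\<in>S. pc_scale c f \<in> S) \<and> U_infty_part \<subseteq> S}\<rparr>"


section \<open>The ideals and the quotients\<close>

definition I_V :: "(pc \<Rightarrow> 'k::field) set" where
  "I_V = Idl\<^bsub>pc_algebra\<^esub>
     {(pc_single (PC [LetA] [LetA]) \<oplus>\<^bsub>pc_algebra\<^esub> pc_single (PC [LetB] [LetB]))
        \<ominus>\<^bsub>pc_algebra\<^esub> \<one>\<^bsub>pc_algebra\<^esub>}"

definition I_infty_gens :: "(pc \<Rightarrow> 'k::field) set" where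
  "I_infty_gens =
     {formal_sum I (\<lambda>i. pc_single (PC (y i) []) \<otimes>\<^bsub>B_infty\<^esub>
          (formal_sum (Q i) (\<lambda>q. pc_single (PC q q)) \<ominus>\<^bsub>B_infty\<^esub> \<one>\<^bsub>B_infty\<^esub>)
          \<otimes>\<^bsub>B_infty\<^esub> pc_single (PC [] (x i))) | (I :: nat set) y x Q.
       inj_on x I \<and> inj_on y I \<and> maximal_prefix_code (x ` I) \<and> maximal_prefix_code (y ` I) \<and>
       (\<forall>i\<in>I. maximal_prefix_code (Q i))}"

definition I_infty :: "(pc \<Rightarrow> 'k::field) set" where
  "I_infty = Idl\<^bsub>A_infty\<^esub> I_infty_gens"

definition C_V :: "(pc \<Rightarrow> 'k::field) set ring" where
  "C_V = pc_algebra Quot I_V"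

definition C_infty :: "(pc \<Rightarrow> 'k::field) set ring" where
  "C_infty = A_infty Quot I_infty"

definition U_V_mod_I_V :: "(pc \<Rightarrow> 'k::field) set set" where
  "U_V_mod_I_V = (\<lambda>u. I_V +>\<^bsub>pc_algebra\<^esub> u) ` U_V"

definition U_infty_mod_I_infty :: "(pc \<Rightarrow> 'k::field) set set" where
  "U_infty_mod_I_infty = (\<lambda>u. I_infty +>\<^bsub>A_infty\<^esub> u) ` U_infty"

end

theory Submission
  imports Defs "HOL-Library.Countable"
begin

text \<open>To an isomorphism \<open>\<phi>\<close> between right ideals attach the formal sum of \<open>\<phi>(x) x\<inverse>\<close> over the prefix code
  \<open>x\<close> generating its domain. In the action of \<open>B\<^sub>\<infinity>\<close> on the free module over the words this sum has
  the matrix of the partial map \<open>\<phi>\<close>, so composition becomes multiplication. The generators of \<open>I\<^sub>\<infinity>\<close>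
  are exactly the differences of the sums of \<open>\<phi>\<close> and of an extension \<open>\<psi>\<close> of \<open>\<phi>\<close>; in the finitely
  generated case such a difference is killed by all sufficiently long words and so lies in \<open>I\<^sub>V\<close>.
  Hence \<open>\<phi>\<close> and its maximum extension agree in the quotient, and maximal isomorphisms map
  multiplicatively onto the images of \<open>U\<^sub>V\<close> and \<open>U\<^sub>\<infinity>\<close>. Conversely, every element of either ideal
  vanishes on an essential right ideal of columns, while distinct maximal isomorphisms differ on
  every essential right ideal; so the map is injective, and the group laws are inherited from the
  quotient algebra.\<close>

text \<open>Vanishing on an essential right ideal of columns does not define a right ideal in all of
  \<open>B_infty\<close>: if \<open>f\<close> vanishes in this sense, \<open>f g\<close> need not,
  since the product of \<open>g\<close> with a word can involve infinitely many monoid elements, and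
  no single extension of that word suits all of them. The remedy is the class
  \<open>near word_span\<close>: every word has an extension that \<open>g\<close> sends to a finite
  combination of words, and finitely many words can be extended in turn until \<open>f\<close> kills
  them all. This class is a subring, closed under scaling, that contains \<open>U_infty_part\<close>
  and the single monoid elements. Hence it contains both algebras, and inside each of them the
  vanishing elements form a two-sided ideal. Infinite sums are controlled by passing to matrix
  entries, each of which is a finite sum. The action is faithful on coefficient functions that
  vanish at the zero of the monoid, so identities in \<open>B_infty\<close> can be proved entry by
  entry.\<close>

section \<open>The algebra \<open>B\<^sub>\<infinity>\<close> as an algebra of matrices\<close>

text \<open>The matrix of \<open>f\<close> in its action on the free module over the words. Only finitely many
  monoid elements map \<open>u\<close> to \<open>v\<close>, so \<open>entry\<close> is linear on all functions.\<close>

definition entry :: "(pc \<Rightarrow> 'k::field) \<Rightarrow> word \<Rightarrow> word \<Rightarrow> 'k" where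
  "entry f v u = (\<Sum>s | pc_act s u = Some v. f s)"

text \<open>An upper bound for the support of column \<open>u\<close> that ignores cancellation. It
  serves as the finite index set over which entries of products are summed.\<close>

definition reach :: "(pc \<Rightarrow> 'k::field) \<Rightarrow> word \<Rightarrow> word set" where
  "reach f u = {v. \<exists>s. f s \<noteq> 0 \<and> pc_act s u = Some v}"

lemma pc_act_eq_Some: "pc_act s u = Some v \<longleftrightarrow> (\<exists>y x z. s = PC y x \<and> u = x @ z \<and> v = y @ z)"
  by (cases s) (auto simp: prefix_def)

lemma finite_prefixes: "finite {x. prefix x u}"
  by (rule finite_subset[of _ "set (prefixes u)"]) auto

lemma finite_pc_act: "finite {s. pc_act s u = Some v}"
proof (rule finite_subset)
  show "{s. pc_act s u = Some v} \<subseteq> (\<lambda>(y, x). PC y x) ` ({y. prefix y v} \<times> {x. prefix x u})"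
    by (auto simp: pc_act_eq_Some)
  show "finite ((\<lambda>(y, x). PC y x) ` ({y. prefix y v} \<times> {x. prefix x u}))"
    by (intro finite_imageI finite_cartesian_product finite_prefixes)
qed

lemma entry_zero [simp]: "entry (\<lambda>p. 0) v u = 0"
  by (simp add: entry_def)

lemma entry_add: "entry (\<lambda>p. f p + g p) v u = entry f v u + entry g v u"
  by (simp add: entry_def sum.distrib)

lemma entry_scale: "entry (pc_scale c f) v u = c * entry f v u"
  by (simp add: entry_def pc_scale_def sum_distrib_left)

text \<open>Faithfulness of the action. The entry at \<open>(y, x)\<close> is the coefficient of
  \<open>PC y x\<close> plus coefficients of elements with a strictly shorter inverse part, so the
  coefficients are recovered by induction on the length of \<open>x\<close>.\<close>

lemma entry_eqI:
  assumes "f PCZero = 0" "g PCZero = 0" and e: "\<And>v u. entry f v u = entry g v u"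
  shows "f = g"
proof -
  have "f (PC y x) = g (PC y x)" for y x
  proof (induction "length x" arbitrary: y x rule: less_induct)
    case less
    have split: "entry h y x = h (PC y x) + (\<Sum>s \<in> {s. pc_act s x = Some y} - {PC y x}. h s)"
      for h :: "pc \<Rightarrow> 'a"
      unfolding entry_def by (rule sum.remove) (auto simp: finite_pc_act)
    have "(\<Sum>s \<in> {s. pc_act s x = Some y} - {PC y x}. f s) =
        (\<Sum>s \<in> {s. pc_act s x = Some y} - {PC y x}. g s)"
      by (rule sum.cong) (auto simp: pc_act_eq_Some intro!: less)
    with e[of y x] show ?case by (simp add: split)
  qed
  with assms(1,2) have "f p = g p" for p by (cases p) auto
  then show ?thesis by auto
qed

lemma B_simps [simp]:
  "mult B_infty = pc_conv" "one B_infty = pc_single (PC [] [])"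
  "zero B_infty = (\<lambda>p. 0)" "add B_infty = (\<lambda>f g p. f p + g p)"
  by (simp_all add: B_infty_def)

text \<open>A word has finitely many prefixes, so finitely many \<open>x\<close> contribute to a
  column, each with finitely many \<open>y\<close>, and symmetrically for rows. Conversely, a
  nonzero coefficient at \<open>PC y x\<close> puts \<open>y\<close> into
  \<open>reach f x\<close>.\<close>

lemma carrier_B_iff: "f \<in> carrier B_infty \<longleftrightarrow> f PCZero = 0 \<and>
    (\<forall>u. finite (reach f u)) \<and> (\<forall>v. finite {u. v \<in> reach f u})"
proof -
  let ?S = "{(y, x). f (PC y x) \<noteq> 0}"
  have "finite (reach f u)" if "\<And>x. finite {y. (y, x) \<in> ?S}" for u
  proof (rule finite_subset)
    show "reach f u \<subseteq> (\<Union>x \<in> {x. prefix x u}. (\<lambda>y. y @ drop (length x) u) ` {y. (y, x) \<in> ?S})"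
    proof
      fix v assume "v \<in> reach f u"
      then obtain y x z where "f (PC y x) \<noteq> 0" "u = x @ z" "v = y @ z"
        by (auto simp: reach_def pc_act_eq_Some)
      then show "v \<in> (\<Union>x \<in> {x. prefix x u}. (\<lambda>y. y @ drop (length x) u) ` {y. (y, x) \<in> ?S})"
        by (intro UN_I[of x] image_eqI[of _ _ y]) auto
    qed
    show "finite \<dots>" using that by (intro finite_UN_I finite_imageI finite_prefixes) auto
  qed
  moreover have "finite {u. v \<in> reach f u}" if "\<And>y. finite {x. (y, x) \<in> ?S}" for v
  proof (rule finite_subset)
    show "{u. v \<in> reach f u} \<subseteq>
        (\<Union>y \<in> {y. prefix y v}. (\<lambda>x. x @ drop (length y) v) ` {x. (y, x) \<in> ?S})"
    proof
      fix u assume "u \<in> {u. v \<in> reach f u}"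
      then obtain y x z where "f (PC y x) \<noteq> 0" "u = x @ z" "v = y @ z"
        by (auto simp: reach_def pc_act_eq_Some)
      then show "u \<in> (\<Union>y \<in> {y. prefix y v}. (\<lambda>x. x @ drop (length y) v) ` {x. (y, x) \<in> ?S})"
        by (intro UN_I[of y] image_eqI[of _ _ x]) auto
    qed
    show "finite \<dots>" using that by (intro finite_UN_I finite_imageI finite_prefixes) auto
  qed
  moreover have "finite {y. (y, x) \<in> ?S}" if "finite (reach f x)" for x
    by (rule finite_subset[OF _ that]) (auto simp: reach_def pc_act_eq_Some)
  moreover have "finite {x. (y, x) \<in> ?S}" if "finite {u. y \<in> reach f u}" for y
    by (rule finite_subset[OF _ that]) (auto simp: reach_def pc_act_eq_Some)
  ultimately show ?thesis
    unfolding B_infty_def finite_to_finite_def by auto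
qed

lemma carrier_BD:
  assumes "f \<in> carrier B_infty"
  shows "f PCZero = 0" "finite (reach f u)" "finite {u. v \<in> reach f u}"
  using assms by (auto simp: carrier_B_iff)

lemma carrier_B_reach:
  assumes "f PCZero = 0"
    and "\<And>u. \<exists>A. finite A \<and> reach f u \<subseteq> A" "\<And>v. \<exists>A. finite A \<and> {u. v \<in> reach f u} \<subseteq> A"
  shows "f \<in> carrier B_infty"
  unfolding carrier_B_iff using assms by (meson finite_subset)

section \<open>Closure properties of \<open>B_infty\<close>\<close>

lemma B_zero_closed: "(\<lambda>p. 0) \<in> carrier B_infty"
  by (auto simp: carrier_B_iff reach_def)

lemma B_add_closed:
  assumes "f \<in> carrier B_infty" "g \<in> carrier B_infty"
  shows "(\<lambda>p. f p + g p) \<in> carrier B_infty"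
proof -
  have r: "reach (\<lambda>p. f p + g p) u \<subseteq> reach f u \<union> reach g u" for u
    unfolding reach_def by force
  show ?thesis
  proof (rule carrier_B_reach)
    show "\<exists>A. finite A \<and> reach (\<lambda>p. f p + g p) u \<subseteq> A" for u
      using r assms by (intro exI[of _ "reach f u \<union> reach g u"]) (auto intro: carrier_BD)
    show "\<exists>A. finite A \<and> {u. v \<in> reach (\<lambda>p. f p + g p) u} \<subseteq> A" for v
      using r assms
      by (intro exI[of _ "{u. v \<in> reach f u} \<union> {u. v \<in> reach g u}"]) (auto intro: carrier_BD)
  qed (use assms in \<open>simp add: carrier_BD\<close>)
qed

lemma B_scale_closed:
  assumes "f \<in> carrier B_infty"
  shows "pc_scale c f \<in> carrier B_infty"
proof -
  have r: "reach (pc_scale c f) u \<subseteq> reach f u" for u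
    unfolding reach_def pc_scale_def by force
  show ?thesis
  proof (rule carrier_B_reach)
    show "\<exists>A. finite A \<and> reach (pc_scale c f) u \<subseteq> A" for u
      using r assms by (intro exI[of _ "reach f u"]) (auto intro: carrier_BD)
    show "\<exists>A. finite A \<and> {u. v \<in> reach (pc_scale c f) u} \<subseteq> A" for v
      using r assms by (intro exI[of _ "{u. v \<in> reach f u}"]) (auto intro: carrier_BD)
  qed (use assms in \<open>simp add: carrier_BD pc_scale_def\<close>)
qed

lemma B_uminus_closed: "f \<in> carrier B_infty \<Longrightarrow> (\<lambda>p. - f p) \<in> carrier B_infty"
  using B_scale_closed[of f "-1"] by (simp add: pc_scale_def)

lemma reach_single: "reach (pc_single s) u \<subseteq> {v. pc_act s u = Some v}"
  by (auto simp: reach_def pc_single_def)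

lemma pc_act_inv: "pc_act s u = Some v \<Longrightarrow> pc_act (pc_inv s) v = Some u"
  by (auto simp: pc_act_eq_Some)

lemma B_single_closed: "pc_single s \<in> carrier B_infty"
proof (rule carrier_B_reach)
  show "\<exists>A. finite A \<and> reach (pc_single s) u \<subseteq> A" for u
    by (rule exI[of _ "{the (pc_act s u)}"]) (use reach_single[of s u] in auto)
  show "\<exists>A. finite A \<and> {u. v \<in> reach (pc_single s) u} \<subseteq> A" for v
  proof (rule exI[of _ "{the (pc_act (pc_inv s) v)}"], safe)
    fix u assume "v \<in> reach (pc_single s) u"
    then have "pc_act s u = Some v" using reach_single by blast
    from pc_act_inv[OF this] show "u = the (pc_act (pc_inv s) v)" by simp
  qed
qed (simp add: pc_single_def)

section \<open>Convolution as matrix multiplication\<close>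

lemma pc_conv_nonzeroD:
  assumes "pc_conv f g p \<noteq> 0"
  obtains s t where "f s \<noteq> 0" "g t \<noteq> 0" "pc_mult s t = p"
proof -
  have "(\<Sum>(s, t) \<in> {(s, t). f s \<noteq> 0 \<and> g t \<noteq> 0 \<and> pc_mult s t = p}. f s * g t) \<noteq> 0"
    using assms by (auto simp: pc_conv_def split: if_splits)
  then obtain a where "a \<in> {(s, t). f s \<noteq> 0 \<and> g t \<noteq> 0 \<and> pc_mult s t = p}"
    by (meson sum.not_neutral_contains_not_neutral)
  then show ?thesis using that by auto
qed

lemma reach_conv: "reach (pc_conv f g) u \<subseteq> (\<Union>w \<in> reach g u. reach f w)"
proof
  fix v assume "v \<in> reach (pc_conv f g) u"
  then obtain p where p: "pc_conv f g p \<noteq> 0" "pc_act p u = Some v" by (auto simp: reach_def)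
  obtain s t where "f s \<noteq> 0" "g t \<noteq> 0" "pc_mult s t = p" using pc_conv_nonzeroD[OF p(1)] .
  with p(2) obtain w where "pc_act t u = Some w" "pc_act s w = Some v"
    by (auto simp: pc_act_mult map_comp_def split: option.splits)
  with \<open>f s \<noteq> 0\<close> \<open>g t \<noteq> 0\<close> show "v \<in> (\<Union>w \<in> reach g u. reach f w)"
    by (auto simp: reach_def)
qed

lemma B_conv_closed:
  assumes "f \<in> carrier B_infty" "g \<in> carrier B_infty"
  shows "pc_conv f g \<in> carrier B_infty"
proof (rule carrier_B_reach)
  show "\<exists>A. finite A \<and> reach (pc_conv f g) u \<subseteq> A" for u
    using reach_conv[of f g u] assms
    by (intro exI[of _ "\<Union>w \<in> reach g u. reach f w"]) (auto intro: carrier_BD)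
  show "\<exists>A. finite A \<and> {u. v \<in> reach (pc_conv f g) u} \<subseteq> A" for v
    using reach_conv[of f g] assms
    by (intro exI[of _ "\<Union>w \<in> {w. v \<in> reach f w}. {u. w \<in> reach g u}"])
      (auto intro: carrier_BD)
qed (simp add: pc_conv_def)

text \<open>\<open>W\<close> may be any finite set containing \<open>reach g u\<close>, so that
  several products can be expanded over a common index set.\<close>

lemma entry_conv:
  assumes g: "g \<in> carrier B_infty" and W: "finite W" "reach g u \<subseteq> W"
  shows "entry (pc_conv f g) v u = (\<Sum>w\<in>W. entry f v w * entry g w u)"
proof -
  define P where "P p = {(s, t). f s \<noteq> 0 \<and> g t \<noteq> 0 \<and> pc_mult s t = p}" for p
  define T where "T w = {s. pc_act s w = Some v} \<times> {t. pc_act t u = Some w}" for w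
  define T' where "T' w = T w \<inter> {(s, t). f s \<noteq> 0 \<and> g t \<noteq> 0}" for w
  have finT: "finite (T w)" "finite (T' w)" for w
    by (simp_all add: T_def T'_def finite_pc_act)
  \<comment> \<open>One set of pairs sorted in two ways: by the product of \<open>s\<close> and
    \<open>t\<close>, and by the intermediate word to which \<open>t\<close> sends
    \<open>u\<close>.\<close>
  have PT: "(\<Union>p \<in> {p. pc_act p u = Some v}. P p) = (\<Union>w\<in>W. T' w)"
    using W(2) by (fastforce simp: P_def T_def T'_def pc_act_mult map_comp_def reach_def
        split: option.splits)
  have finP: "finite (P p)" if "pc_act p u = Some v" for p
  proof (rule finite_subset)
    show "P p \<subseteq> (\<Union>w\<in>W. T' w)" using PT that by blast
  qed (use W finT in auto)
  have "entry (pc_conv f g) v u = (\<Sum>p | pc_act p u = Some v. \<Sum>(s, t) \<in> P p. f s * g t)"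
    unfolding entry_def by (rule sum.cong) (auto simp: pc_conv_def P_def)
  also have "\<dots> = (\<Sum>(s, t) \<in> (\<Union>p \<in> {p. pc_act p u = Some v}. P p). f s * g t)"
    by (subst sum.UNION_disjoint) (auto simp: finite_pc_act finP, auto simp: P_def)
  also have "\<dots> = (\<Sum>w\<in>W. \<Sum>(s, t) \<in> T' w. f s * g t)"
    unfolding PT by (subst sum.UNION_disjoint) (auto simp: finT W, auto simp: T_def T'_def)
  \<comment> \<open>The pairs added here have a zero factor; with them each inner sum splits into a
    product of two entries.\<close>
  also have "\<dots> = (\<Sum>w\<in>W. \<Sum>(s, t) \<in> T w. f s * g t)"
    by (intro sum.cong refl sum.mono_neutral_left) (auto simp: finT, auto simp: T'_def)
  also have "\<dots> = (\<Sum>w\<in>W. entry f v w * entry g w u)"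
    by (simp add: T_def entry_def sum_product sum.cartesian_product)
  finally show ?thesis .
qed

text \<open>Associativity of matrix multiplication, read back through \<open>entry_eqI\<close>. Both
  index sets are finite, so the sums may be interchanged although \<open>f\<close>, \<open>g\<close>
  and \<open>h\<close> can have infinite support.\<close>

lemma pc_conv_assoc:
  assumes f: "f \<in> carrier B_infty" and g: "g \<in> carrier B_infty" and h: "h \<in> carrier B_infty"
  shows "pc_conv (pc_conv f g) h = pc_conv f (pc_conv g h)"
proof (rule entry_eqI)
  fix v u
  let ?R = "\<Union>w \<in> reach h u. reach g w"
  have fin: "finite (reach h u)" "finite ?R" using g h by (auto intro: carrier_BD)
  have "entry (pc_conv (pc_conv f g) h) v u =
      (\<Sum>w \<in> reach h u. entry (pc_conv f g) v w * entry h w u)"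
    by (rule entry_conv) (use h fin in auto)
  also have "\<dots> = (\<Sum>w \<in> reach h u. \<Sum>w' \<in> ?R. entry f v w' * entry g w' w * entry h w u)"
    by (intro sum.cong refl, subst entry_conv[where W = ?R])
      (use g fin in \<open>auto simp: sum_distrib_right\<close>)
  also have "\<dots> = (\<Sum>w' \<in> ?R. \<Sum>w \<in> reach h u. entry f v w' * entry g w' w * entry h w u)"
    by (rule sum.swap)
  also have "\<dots> = (\<Sum>w' \<in> ?R. entry f v w' * entry (pc_conv g h) w' u)"
    by (intro sum.cong refl, subst entry_conv[where W = "reach h u"])
      (use h fin in \<open>auto simp: sum_distrib_left mult.assoc\<close>)
  also have "\<dots> = entry (pc_conv f (pc_conv g h)) v u"
    by (rule entry_conv[symmetric]) (use g h fin reach_conv[of g h u] in \<open>auto simp: B_conv_closed\<close>)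
  finally show "entry (pc_conv (pc_conv f g) h) v u = entry (pc_conv f (pc_conv g h)) v u" .
qed (simp_all add: pc_conv_def)

lemma pc_conv_add_right:
  assumes g: "g \<in> carrier B_infty" and h: "h \<in> carrier B_infty"
  shows "pc_conv f (\<lambda>p. g p + h p) = (\<lambda>p. pc_conv f g p + pc_conv f h p)"
proof (rule entry_eqI)
  fix v u
  let ?W = "reach g u \<union> reach h u"
  have "finite ?W" using g h by (simp add: carrier_BD)
  moreover have "reach (\<lambda>p. g p + h p) u \<subseteq> ?W" unfolding reach_def by force
  ultimately show "entry (pc_conv f (\<lambda>p. g p + h p)) v u =
      entry (\<lambda>p. pc_conv f g p + pc_conv f h p) v u"
    using g h B_add_closed[OF g h]
    by (simp add: entry_add entry_conv[where W = ?W] sum.distrib distrib_left)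
qed (simp_all add: pc_conv_def)

lemma pc_conv_add_left:
  assumes h: "h \<in> carrier B_infty"
  shows "pc_conv (\<lambda>p. f p + g p) h = (\<lambda>p. pc_conv f h p + pc_conv g h p)"
proof (rule entry_eqI)
  fix v u
  have "finite (reach h u)" using h by (simp add: carrier_BD)
  then show "entry (pc_conv (\<lambda>p. f p + g p) h) v u =
      entry (\<lambda>p. pc_conv f h p + pc_conv g h p) v u"
    using h by (simp add: entry_add entry_conv[where W = "reach h u"] sum.distrib distrib_right)
qed (simp_all add: pc_conv_def)

lemma pc_conv_scale_right:
  assumes g: "g \<in> carrier B_infty"
  shows "pc_conv f (pc_scale c g) = pc_scale c (pc_conv f g)"
proof (rule entry_eqI)
  fix v u
  have "finite (reach g u)" using g by (simp add: carrier_BD)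
  moreover have "reach (pc_scale c g) u \<subseteq> reach g u" unfolding reach_def pc_scale_def by force
  ultimately show "entry (pc_conv f (pc_scale c g)) v u = entry (pc_scale c (pc_conv f g)) v u"
    using g B_scale_closed[OF g, of c]
    by (simp add: entry_scale entry_conv[where W = "reach g u"] sum_distrib_left algebra_simps)
qed (simp_all add: pc_conv_def pc_scale_def)

lemma pc_conv_scale_left:
  assumes g: "g \<in> carrier B_infty"
  shows "pc_conv (pc_scale c f) g = pc_scale c (pc_conv f g)"
proof (rule entry_eqI)
  fix v u
  have "finite (reach g u)" using g by (simp add: carrier_BD)
  then show "entry (pc_conv (pc_scale c f) g) v u = entry (pc_scale c (pc_conv f g)) v u"
    using g
    by (simp add: entry_scale entry_conv[where W = "reach g u"] sum_distrib_left algebra_simps)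
qed (simp_all add: pc_conv_def pc_scale_def)

lemma entry_one: "entry (pc_single (PC [] []) :: pc \<Rightarrow> 'k::field) v u = (if v = u then 1 else 0)"
proof -
  have "entry (pc_single (PC [] [])) v u =
      (\<Sum>s | pc_act s u = Some v. if s = PC [] [] then 1 else (0::'k))"
    unfolding entry_def by (rule sum.cong) (auto simp: pc_single_def)
  then show ?thesis by (auto simp: sum.delta finite_pc_act)
qed

lemma ring_B_infty: "ring (B_infty :: (pc \<Rightarrow> 'k::field) ring)"
proof (rule ringI)
  show "abelian_group (B_infty :: (pc \<Rightarrow> 'k) ring)"
  proof (rule abelian_groupI)
    fix f :: "pc \<Rightarrow> 'k" assume "f \<in> carrier B_infty"
    then show "\<exists>g\<in>carrier B_infty. g \<oplus>\<^bsub>B_infty\<^esub> f = \<zero>\<^bsub>B_infty\<^esub>"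
      by (intro bexI[of _ "\<lambda>p. - f p"]) (auto simp: B_uminus_closed)
  qed (auto simp: B_add_closed B_zero_closed algebra_simps)
  show "monoid (B_infty :: (pc \<Rightarrow> 'k) ring)"
  proof (rule monoidI)
    fix f :: "pc \<Rightarrow> 'k" assume f: "f \<in> carrier B_infty"
    have "pc_conv (pc_single (PC [] [])) f = f"
    proof (rule entry_eqI)
      fix v u
      \<comment> \<open>\<open>v\<close> is inserted because it may lie outside
        \<open>reach f u\<close>; the sum then always contains the diagonal term.\<close>
      have "entry (pc_conv (pc_single (PC [] [])) f) v u =
          (\<Sum>w \<in> insert v (reach f u). (if v = w then 1 else 0) * entry f w u)"
        by (subst entry_conv[OF f, of "insert v (reach f u)"])
          (auto simp: carrier_BD[OF f] entry_one)
      also have "\<dots> = (\<Sum>w \<in> insert v (reach f u). if v = w then entry f w u else 0)"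
        by (rule sum.cong) auto
      finally show "entry (pc_conv (pc_single (PC [] [])) f) v u = entry f v u"
        by (simp add: carrier_BD[OF f])
    qed (simp_all add: pc_conv_def carrier_BD[OF f])
    then show "\<one>\<^bsub>B_infty\<^esub> \<otimes>\<^bsub>B_infty\<^esub> f = f" by simp
    have "pc_conv f (pc_single (PC [] [])) = f"
    proof (rule entry_eqI)
      fix v u
      show "entry (pc_conv f (pc_single (PC [] []))) v u = entry f v u"
        using reach_single[of "PC [] []" u]
        by (subst entry_conv[OF B_single_closed, of "{u}"]) (auto simp: entry_one)
    qed (simp_all add: pc_conv_def carrier_BD[OF f])
    then show "f \<otimes>\<^bsub>B_infty\<^esub> \<one>\<^bsub>B_infty\<^esub> = f" by simp
  qed (simp_all add: B_conv_closed B_single_closed pc_conv_assoc)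
qed (auto simp: pc_conv_add_left pc_conv_add_right)

lemma B_a_inv:
  assumes "f \<in> carrier B_infty"
  shows "\<ominus>\<^bsub>B_infty\<^esub> f = (\<lambda>p. - f p)"
proof -
  interpret ring "B_infty :: (pc \<Rightarrow> 'a) ring" by (rule ring_B_infty)
  show ?thesis
    by (rule minus_equality) (use assms in \<open>auto simp: B_uminus_closed\<close>)
qed

section \<open>Right ideals, prefix codes and isomorphisms\<close>

text \<open>For a right ideal \<open>R\<close> this is the unique prefix code that generates
  \<open>R\<close>.\<close>

definition min_words :: "word set \<Rightarrow> word set" where
  "min_words R = {u \<in> R. \<forall>v\<in>R. \<not> strict_prefix v u}"

lemma ex_min_word:
  assumes "u \<in> R"
  obtains m z where "m \<in> min_words R" "u = m @ z"
proof -
  have "\<exists>m z. m \<in> min_words R \<and> u = m @ z" using assms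
  proof (induction "length u" arbitrary: u rule: less_induct)
    case less
    show ?case
    proof (cases "u \<in> min_words R")
      case True
      then show ?thesis by (intro exI[of _ u] exI[of _ "[]"]) auto
    next
      case False
      then obtain v where "v \<in> R" "strict_prefix v u"
        using less.prems by (auto simp: min_words_def)
      with less.hyps[of v] show ?thesis
        by (metis append.assoc prefix_def prefix_length_less strict_prefix_def)
    qed
  qed
  then show ?thesis using that by blast
qed

lemma min_words_sub: "m \<in> min_words R \<Longrightarrow> m \<in> R"
  by (simp add: min_words_def)

lemma min_words_unique:
  assumes "m \<in> min_words R" "n \<in> R" "prefix n m"
  shows "m = n"
  using assms by (auto simp: min_words_def strict_prefix_def)

text \<open>Two prefixes of one word are comparable, and comparable minimal words coincide. Thus a
  word factors through a minimal word in only one way.\<close>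

lemma min_words_comparable:
  assumes "m \<in> min_words R" "n \<in> min_words R" "m @ z = n @ z'"
  shows "m = n" "z = z'"
proof -
  have "prefix m n \<or> prefix n m" using assms(3) by (metis prefixI prefix_same_cases)
  then show "m = n" using assms(1,2) by (metis min_words_sub min_words_unique)
  then show "z = z'" using assms(3) by simp
qed

lemma right_ideal_append: "right_ideal R \<Longrightarrow> u \<in> R \<Longrightarrow> u @ z \<in> R"
  by (simp add: right_ideal_def)

text \<open>Only principal right ideals have to be met, since every non-empty right ideal contains
  one.\<close>

lemma essential_iff: "essential R \<longleftrightarrow> right_ideal R \<and> (\<forall>w. \<exists>z. w @ z \<in> R)"
proof
  assume R: "right_ideal R \<and> (\<forall>w. \<exists>z. w @ z \<in> R)"
  show "essential R" unfolding essential_def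
  proof (intro conjI allI impI)
    fix S assume S: "right_ideal S \<and> S \<noteq> {}"
    then obtain s where "s \<in> S" by auto
    with R S show "R \<inter> S \<noteq> {}" by (metis right_ideal_append disjoint_iff)
  qed (use R in blast)
qed (auto simp: essential_meets, simp add: essential_def)

lemma essential_right_ideal: "essential R \<Longrightarrow> right_ideal R"
  by (simp add: essential_def)

text \<open>A prefix code can be enlarged exactly when some word is incomparable with all its
  members.\<close>

lemma maximal_prefix_code_iff:
  "maximal_prefix_code P \<longleftrightarrow> prefix_code P \<and> (\<forall>w. \<exists>p\<in>P. prefix p w \<or> prefix w p)"
proof
  assume P: "maximal_prefix_code P"
  have "\<exists>p\<in>P. prefix p w \<or> prefix w p" for w
  proof (rule ccontr)
    assume w: "\<not> ?thesis"
    then have "prefix_code (insert w P)"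
      using P by (auto simp: maximal_prefix_code_def prefix_code_def strict_prefix_def)
    moreover have "P \<subset> insert w P" using w by auto
    ultimately show False using P by (auto simp: maximal_prefix_code_def)
  qed
  with P show "prefix_code P \<and> (\<forall>w. \<exists>p\<in>P. prefix p w \<or> prefix w p)"
    by (simp add: maximal_prefix_code_def)
next
  assume P: "prefix_code P \<and> (\<forall>w. \<exists>p\<in>P. prefix p w \<or> prefix w p)"
  have "\<not> prefix_code Q" if sub: "P \<subset> Q" for Q
  proof -
    obtain w where w: "w \<in> Q" "w \<notin> P" using sub by blast
    obtain p where "p \<in> P" "prefix p w \<or> prefix w p" using P by blast
    with w sub have "p \<in> Q" "strict_prefix p w \<or> strict_prefix w p"
      by (auto simp: strict_prefix_def)
    with w show ?thesis by (auto simp: prefix_code_def)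
  qed
  with P show "maximal_prefix_code P" by (auto simp: maximal_prefix_code_def)
qed

lemma prefix_code_comparable:
  assumes "prefix_code P" "p \<in> P" "q \<in> P" "p @ z = q @ z'"
  shows "p = q" "z = z'"
proof -
  have "prefix p q \<or> prefix q p" using assms(4) by (metis prefixI prefix_same_cases)
  then show "p = q" using assms(1-3) by (auto simp: prefix_code_def strict_prefix_def)
  then show "z = z'" using assms(4) by simp
qed

lemma fin_gen_iff_min_words:
  assumes "right_ideal R"
  shows "fin_gen R \<longleftrightarrow> finite (min_words R)"
proof
  assume "fin_gen R"
  then obtain F where F: "finite F" "R = {u @ x | u x. u \<in> F}" by (auto simp: fin_gen_def)
  have "min_words R \<subseteq> F"
  proof
    fix m assume m: "m \<in> min_words R"
    then obtain u x where u: "m = u @ x" "u \<in> F" using F min_words_sub by blast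
    moreover have "u \<in> R" using u(2) unfolding F(2) by (metis (mono_tags, lifting) append_Nil2 mem_Collect_eq)
    ultimately have "m = u" using m by (metis min_words_unique prefixI)
    with u show "m \<in> F" by simp
  qed
  with F show "finite (min_words R)" by (meson finite_subset)
next
  assume "finite (min_words R)"
  moreover have "R = {u @ x | u x. u \<in> min_words R}"
    using ex_min_word[of _ R] min_words_sub right_ideal_append[OF assms] by blast
  ultimately show "fin_gen R" unfolding fin_gen_def by blast
qed

lemma finite_words_of_length: "finite {w :: word. length w \<le> n}"
proof -
  have "UNIV = {LetA, LetB}" using letter.exhaust by auto
  then have "finite (UNIV :: letter set)" by (metis finite.emptyI finite_insert)
  from finite_lists_length_le[OF this, of n] show ?thesis by simp
qed

text \<open>The longest minimal word gives the bound. Conversely, a minimal word longer than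
  \<open>n\<close> would have its prefix of length \<open>n\<close> in \<open>R\<close>, and over a
  finite alphabet only finitely many shorter candidates exist. In this form finite generation passes
  easily to composites, inverses and extensions.\<close>

lemma fin_gen_iff_long:
  assumes "essential R"
  shows "fin_gen R \<longleftrightarrow> (\<exists>n. \<forall>w. n \<le> length w \<longrightarrow> w \<in> R)"
proof
  assume "fin_gen R"
  then have fin: "finite (min_words R)"
    using assms fin_gen_iff_min_words essential_right_ideal by blast
  show "\<exists>n. \<forall>w. n \<le> length w \<longrightarrow> w \<in> R"
  proof (intro exI allI impI)
    fix w :: word assume w: "Max (length ` min_words R) \<le> length w"
    obtain z where "w @ z \<in> R" using assms essential_meets by blast
    then obtain m z' where m: "m \<in> min_words R" "w @ z = m @ z'" using ex_min_word by metis
    have "length m \<le> length w" using w fin m(1) by (meson Max_ge finite_imageI imageI order_trans)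
    with m(2) have "prefix m w" by (metis prefixI prefix_length_prefix)
    then have "w = m @ drop (length m) w" by (auto simp: prefix_def)
    with m(1) assms show "w \<in> R"
      by (metis essential_right_ideal min_words_sub right_ideal_append)
  qed
next
  assume "\<exists>n. \<forall>w. n \<le> length w \<longrightarrow> w \<in> R"
  then obtain n where n: "\<And>w. n \<le> length w \<Longrightarrow> w \<in> R" by blast
  have "min_words R \<subseteq> {w. length w \<le> n}"
  proof
    fix m assume m: "m \<in> min_words R"
    show "m \<in> {w. length w \<le> n}"
    proof (rule ccontr)
      assume "m \<notin> {w. length w \<le> n}"
      then have "n < length m" by simp
      moreover from this have "take n m \<in> R" by (intro n) simp
      ultimately have "m = take n m" using m by (metis min_words_unique take_is_prefix)
      with \<open>n < length m\<close> show False by (metis length_take min.strict_order_iff order.irrefl min.commute)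
    qed
  qed
  then have "finite (min_words R)" using finite_words_of_length finite_subset by blast
  then show "fin_gen R" using assms fin_gen_iff_min_words essential_right_ideal by blast
qed

section \<open>Isomorphisms between essential right ideals\<close>

definition ess_iso :: "(word \<rightharpoonup> word) \<Rightarrow> bool" where
  "ess_iso \<phi> \<longleftrightarrow> right_ideal_iso \<phi> \<and> essential (dom \<phi>) \<and> essential (ran \<phi>)"

definition fg_iso :: "(word \<rightharpoonup> word) \<Rightarrow> bool" where
  "fg_iso \<phi> \<longleftrightarrow> ess_iso \<phi> \<and> fin_gen (dom \<phi>) \<and> fin_gen (ran \<phi>)"

lemma right_ideal_isoI:
  assumes "\<And>u v x. \<phi> u = Some v \<Longrightarrow> \<phi> (u @ x) = Some (v @ x)"
    and "\<And>u u' v. \<phi> u = Some v \<Longrightarrow> \<phi> u' = Some v \<Longrightarrow> u = u'"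
  shows "right_ideal_iso \<phi>"
proof -
  have "right_ideal (dom \<phi>)" "right_ideal (ran \<phi>)"
    using assms(1) by (auto simp: right_ideal_def ran_def)
  moreover have "inj_on \<phi> (dom \<phi>)"
    by (rule inj_onI) (use assms(2) in force)
  ultimately show ?thesis using assms(1) by (simp add: right_ideal_iso_def)
qed

lemma right_ideal_iso_dom: "right_ideal_iso \<phi> \<Longrightarrow> right_ideal (dom \<phi>)"
  and right_ideal_iso_ran: "right_ideal_iso \<phi> \<Longrightarrow> right_ideal (ran \<phi>)"
  by (simp_all add: right_ideal_iso_def)

lemma ess_iso_iff: "ess_iso \<phi> \<longleftrightarrow> right_ideal_iso \<phi> \<and>
    (\<forall>w. \<exists>z v. \<phi> (w @ z) = Some v) \<and> (\<forall>w. \<exists>z u. \<phi> u = Some (w @ z))"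
proof -
  have "u \<in> dom \<phi> \<longleftrightarrow> (\<exists>v. \<phi> u = Some v)" "v \<in> ran \<phi> \<longleftrightarrow> (\<exists>u. \<phi> u = Some v)" for u v
    by (auto simp: ran_def)
  then show ?thesis
    using right_ideal_iso_dom[of \<phi>] right_ideal_iso_ran[of \<phi>]
    by (auto simp: ess_iso_def essential_iff simp del: domIff)
qed

lemma ess_isoD:
  assumes "ess_iso \<phi>"
  shows "right_ideal_iso \<phi>" "\<exists>z v. \<phi> (w @ z) = Some v" "\<exists>z u. \<phi> u = Some (w @ z)"
  using assms by (auto simp: ess_iso_iff)

lemma fg_iso_iff: "fg_iso \<phi> \<longleftrightarrow> ess_iso \<phi> \<and>
    (\<exists>n. \<forall>w. n \<le> length w \<longrightarrow> (\<exists>v. \<phi> w = Some v)) \<and>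
    (\<exists>n. \<forall>w. n \<le> length w \<longrightarrow> (\<exists>u. \<phi> u = Some w))"
proof (cases "ess_iso \<phi>")
  case True
  then have "essential (dom \<phi>)" "essential (ran \<phi>)" by (auto simp: ess_iso_def)
  then show ?thesis by (simp add: True fg_iso_def fin_gen_iff_long ran_def dom_def)
qed (simp add: fg_iso_def)

lemma right_ideal_iso_comp:
  assumes "right_ideal_iso \<phi>" "right_ideal_iso \<psi>"
  shows "right_ideal_iso (\<phi> \<circ>\<^sub>m \<psi>)"
proof (rule right_ideal_isoI)
  show "(\<phi> \<circ>\<^sub>m \<psi>) u = Some v \<Longrightarrow> (\<phi> \<circ>\<^sub>m \<psi>) (u @ x) = Some (v @ x)" for u v x
    using assms by (auto simp: map_comp_Some_iff dest: right_ideal_isoD(1))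
  show "u = u'" if "(\<phi> \<circ>\<^sub>m \<psi>) u = Some v" "(\<phi> \<circ>\<^sub>m \<psi>) u' = Some v" for u u' v
    using that assms right_ideal_isoD(2) unfolding map_comp_Some_iff by metis
qed

lemma ess_iso_comp:
  assumes "ess_iso \<phi>" "ess_iso \<psi>"
  shows "ess_iso (\<phi> \<circ>\<^sub>m \<psi>)"
proof -
  note r = ess_isoD(1)[OF assms(1)] ess_isoD(1)[OF assms(2)]
  have "\<exists>z v. (\<phi> \<circ>\<^sub>m \<psi>) (w @ z) = Some v" for w
  proof -
    obtain z v where 1: "\<psi> (w @ z) = Some v" using ess_isoD(2)[OF assms(2)] by blast
    obtain z' v' where "\<phi> (v @ z') = Some v'" using ess_isoD(2)[OF assms(1)] by blast
    with right_ideal_isoD(1)[OF r(2) 1, of z'] have "(\<phi> \<circ>\<^sub>m \<psi>) (w @ z @ z') = Some v'" by simp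
    then show ?thesis by blast
  qed
  moreover have "\<exists>z u. (\<phi> \<circ>\<^sub>m \<psi>) u = Some (w @ z)" for w
  proof -
    obtain z v where 1: "\<phi> v = Some (w @ z)" using ess_isoD(3)[OF assms(1)] by blast
    obtain z' u where "\<psi> u = Some (v @ z')" using ess_isoD(3)[OF assms(2)] by blast
    with right_ideal_isoD(1)[OF r(1) 1, of z'] have "(\<phi> \<circ>\<^sub>m \<psi>) u = Some (w @ z @ z')" by simp
    then show ?thesis by blast
  qed
  ultimately show ?thesis using r by (auto simp: ess_iso_iff right_ideal_iso_comp)
qed

lemma fg_iso_comp:
  assumes "fg_iso \<phi>" "fg_iso \<psi>"
  shows "fg_iso (\<phi> \<circ>\<^sub>m \<psi>)"
proof -
  note r = assms[unfolded fg_iso_iff]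
  have e: "right_ideal_iso \<phi>" "right_ideal_iso \<psi>" using r ess_isoD(1) by blast+
  obtain m n where m: "\<And>w. m \<le> length w \<Longrightarrow> \<exists>v. \<phi> w = Some v"
    and n: "\<And>w. n \<le> length w \<Longrightarrow> \<exists>v. \<psi> w = Some v" using r by blast
  \<comment> \<open>The first \<open>n\<close> letters suffice to apply \<psi>. The other letters,
    at least \<open>m\<close> of them, are carried along unchanged, so the image is long enough for
    \<phi>.\<close>
  have "\<exists>v. (\<phi> \<circ>\<^sub>m \<psi>) w = Some v" if l: "n + m \<le> length w" for w
  proof -
    obtain v where "\<psi> (take n w) = Some v" using n[of "take n w"] l by auto
    from right_ideal_isoD(1)[OF e(2) this, of "drop n w"]
    have "\<psi> w = Some (v @ drop n w)" by simp
    moreover have "m \<le> length (v @ drop n w)" using l by simp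
    then obtain v' where "\<phi> (v @ drop n w) = Some v'" using m by blast
    ultimately show ?thesis by simp
  qed
  moreover obtain m' n' where m': "\<And>w. m' \<le> length w \<Longrightarrow> \<exists>u. \<phi> u = Some w"
    and n': "\<And>w. n' \<le> length w \<Longrightarrow> \<exists>u. \<psi> u = Some w" using r by blast
  have "\<exists>u. (\<phi> \<circ>\<^sub>m \<psi>) u = Some w" if l: "m' + n' \<le> length w" for w
  proof -
    obtain v where "\<phi> v = Some (take m' w)" using m'[of "take m' w"] l by auto
    from right_ideal_isoD(1)[OF e(1) this, of "drop m' w"]
    have "\<phi> (v @ drop m' w) = Some w" by simp
    moreover have "n' \<le> length (v @ drop m' w)" using l by simp
    then obtain u where "\<psi> u = Some (v @ drop m' w)" using n' by blast
    ultimately show ?thesis by (intro exI[of _ u]) simp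
  qed
  ultimately show ?thesis using r by (auto simp: fg_iso_iff ess_iso_comp)
qed

lemma ess_iso_extension:
  assumes "ess_iso \<phi>" "\<phi> \<subseteq>\<^sub>m \<psi>" "right_ideal_iso \<psi>"
  shows "ess_iso \<psi>"
  using assms unfolding ess_iso_iff map_le_def by (metis domI)

lemma fg_iso_extension:
  assumes "fg_iso \<phi>" "\<phi> \<subseteq>\<^sub>m \<psi>" "right_ideal_iso \<psi>"
  shows "fg_iso \<psi>"
  using assms ess_iso_extension[of \<phi> \<psi>] unfolding fg_iso_iff map_le_def by (metis domI)

definition iso_inv :: "(word \<rightharpoonup> word) \<Rightarrow> word \<rightharpoonup> word" where
  "iso_inv \<phi> v = (if v \<in> ran \<phi> then Some (SOME u. \<phi> u = Some v) else None)"

lemma iso_inv_iff: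
  assumes "right_ideal_iso \<phi>"
  shows "iso_inv \<phi> v = Some u \<longleftrightarrow> \<phi> u = Some v"
proof -
  have "(SOME u. \<phi> u = Some v) = u" if "\<phi> u = Some v" for u
    using that right_ideal_isoD(2)[OF assms] by blast
  then show ?thesis by (auto simp: iso_inv_def ran_def)
qed

lemma ess_iso_inv: "ess_iso \<phi> \<Longrightarrow> ess_iso (iso_inv \<phi>)"
  and fg_iso_inv: "fg_iso \<phi> \<Longrightarrow> fg_iso (iso_inv \<phi>)"
proof -
  show *: "ess_iso (iso_inv \<phi>)" if "ess_iso \<phi>"
  proof -
    note i = iso_inv_iff[OF ess_isoD(1)[OF that]]
    have "right_ideal_iso (iso_inv \<phi>)"
      by (rule right_ideal_isoI) (use right_ideal_isoD(1)[OF ess_isoD(1)[OF that]] in \<open>auto simp: i\<close>)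
    then show ?thesis using that by (auto simp: ess_iso_iff i)
  qed
  show "fg_iso (iso_inv \<phi>)" if "fg_iso \<phi>"
  proof -
    have e: "ess_iso \<phi>" using that by (simp add: fg_iso_iff)
    note i = iso_inv_iff[OF ess_isoD(1)[OF e]]
    show ?thesis using that *[OF e] by (auto simp: fg_iso_iff i)
  qed
qed

lemma iso_inv_comp_le:
  assumes "right_ideal_iso \<phi>"
  shows "iso_inv \<phi> \<circ>\<^sub>m \<phi> \<subseteq>\<^sub>m Some"
  using iso_inv_iff[OF assms] by (auto simp: map_le_def map_comp_Some_iff dom_def)

lemma fg_iso_Some: "fg_iso Some"
  by (auto simp: fg_iso_iff ess_iso_iff intro: right_ideal_isoI)

lemma maximal_iso_Some: "maximal_iso Some"
  using fg_iso_Some by (auto simp: maximal_iso_def fg_iso_iff ess_iso_iff map_le_def)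

section \<open>Restriction and maximum extension\<close>

lemma right_ideal_iso_restrict:
  assumes "right_ideal_iso \<phi>" "right_ideal D"
  shows "right_ideal_iso (\<phi> |` D)"
proof (rule right_ideal_isoI)
  show "(\<phi> |` D) (u @ x) = Some (v @ x)" if "(\<phi> |` D) u = Some v" for u v x
    using that assms right_ideal_isoD(1)[OF assms(1)]
    by (auto simp: restrict_map_def right_ideal_append split: if_splits)
  show "u = u'" if "(\<phi> |` D) u = Some v" "(\<phi> |` D) u' = Some v" for u u' v
    using that right_ideal_isoD(2)[OF assms(1)] by (auto simp: restrict_map_def split: if_splits)
qed

lemma ess_iso_restrict:
  assumes "ess_iso \<phi>" "essential D"
  shows "ess_iso (\<phi> |` D)"
proof -
  note r = ess_isoD(1)[OF assms(1)]
  have D: "right_ideal D" using assms(2) by (rule essential_right_ideal)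
  have "\<exists>z v. (\<phi> |` D) (w @ z) = Some v" for w
  proof -
    obtain z v where 1: "\<phi> (w @ z) = Some v" using ess_isoD(2)[OF assms(1)] by blast
    obtain z' where "(w @ z) @ z' \<in> D" using essential_meets[OF assms(2)] by blast
    with right_ideal_isoD(1)[OF r 1, of z'] show ?thesis
      by (intro exI[of _ "z @ z'"] exI[of _ "v @ z'"]) auto
  qed
  moreover have "\<exists>z u. (\<phi> |` D) u = Some (w @ z)" for w
  proof -
    obtain z u where 1: "\<phi> u = Some (w @ z)" using ess_isoD(3)[OF assms(1)] by blast
    obtain z' where "u @ z' \<in> D" using essential_meets[OF assms(2)] by blast
    with right_ideal_isoD(1)[OF r 1, of z'] show ?thesis
      by (intro exI[of _ "z @ z'"] exI[of _ "u @ z'"]) auto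
  qed
  ultimately show ?thesis using right_ideal_iso_restrict[OF r D] by (simp add: ess_iso_iff)
qed

lemma is_max_extension_max_extension:
  assumes "ess_iso \<phi>"
  shows "is_max_extension \<phi> (max_extension \<phi>)"
  using theI'[OF ex1_max_extension[of \<phi>]] assms by (simp add: max_extension_def ess_iso_def)

lemma max_extension:
  assumes "ess_iso \<phi>"
  shows "right_ideal_iso (max_extension \<phi>)" "\<phi> \<subseteq>\<^sub>m max_extension \<phi>"
    "maximal_iso (max_extension \<phi>)"
proof -
  note m = is_max_extension_max_extension[OF assms, unfolded is_max_extension_def]
  show "right_ideal_iso (max_extension \<phi>)" "\<phi> \<subseteq>\<^sub>m max_extension \<phi>" using m by auto
  then show "maximal_iso (max_extension \<phi>)"
    using m unfolding maximal_iso_def by (meson map_le_antisym map_le_trans)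
qed

text \<open>The set \<open>D\<close> on which the two maps agree is an essential right ideal. Both
  maps extend the restriction to \<open>D\<close>, so both lie below its maximum extension, and by
  maximality both equal it.\<close>

lemma maximal_iso_eqI:
  assumes "maximal_iso \<phi>" "maximal_iso \<psi>" and "ess_iso \<phi>"
    and agree: "\<And>w. \<exists>z. \<phi> (w @ z) \<noteq> None \<and> \<phi> (w @ z) = \<psi> (w @ z)"
  shows "\<phi> = \<psi>"
proof -
  define D where "D = {u. \<phi> u \<noteq> None \<and> \<phi> u = \<psi> u}"
  have r: "right_ideal_iso \<phi>" "right_ideal_iso \<psi>" using assms(1,2) by (auto simp: maximal_iso_def)
  have "right_ideal D" unfolding right_ideal_def
  proof safe
    fix u x assume "u \<in> D"
    then obtain v where "\<phi> u = Some v" "\<psi> u = Some v" unfolding D_def by force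
    then have "\<phi> (u @ x) = Some (v @ x)" "\<psi> (u @ x) = Some (v @ x)"
      using r right_ideal_isoD(1) by blast+
    then show "u @ x \<in> D" by (simp add: D_def)
  qed
  then have "essential D" using agree by (auto simp: essential_iff D_def)
  then have e: "ess_iso (\<phi> |` D)" using assms(3) by (rule ess_iso_restrict[rotated])
  have "\<phi> |` D \<subseteq>\<^sub>m \<phi>" "\<phi> |` D \<subseteq>\<^sub>m \<psi>"
    by (auto simp: map_le_def restrict_map_def D_def dom_def split: if_splits)
  then have "\<phi> \<subseteq>\<^sub>m max_extension (\<phi> |` D)" "\<psi> \<subseteq>\<^sub>m max_extension (\<phi> |` D)"
    using is_max_extension_max_extension[OF e] r by (auto simp: is_max_extension_def)
  with assms(1,2) max_extension(1)[OF e] show ?thesis unfolding maximal_iso_def by metis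
qed

section \<open>The sum attached to an isomorphism\<close>

definition iso_sum :: "(word \<rightharpoonup> word) \<Rightarrow> pc \<Rightarrow> 'k::field" where
  "iso_sum \<phi> p = (case p of PCZero \<Rightarrow> 0
     | PC y x \<Rightarrow> if x \<in> min_words (dom \<phi>) \<and> \<phi> x = Some y then 1 else 0)"

lemma iso_sum_simps [simp]:
  "iso_sum \<phi> PCZero = 0"
  "iso_sum \<phi> (PC y x) = (if x \<in> min_words (dom \<phi>) \<and> \<phi> x = Some y then 1 else 0)"
  by (simp_all add: iso_sum_def)

text \<open>A word has at most one prefix in the code \<open>min_words (dom \<phi>)\<close>, so at
  most one term of the sum acts on it.\<close>

lemma entry_iso_sum:
  assumes "right_ideal_iso \<phi>"
  shows "entry (iso_sum \<phi> :: pc \<Rightarrow> 'k::field) v u = (if \<phi> u = Some v then 1 else 0)"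
proof -
  let ?S = "{s. pc_act s u = Some v \<and> (iso_sum \<phi> s :: 'k) \<noteq> 0}"
  have S: "s \<in> ?S \<longleftrightarrow> (\<exists>m y z. s = PC y m \<and> m \<in> min_words (dom \<phi>) \<and> \<phi> m = Some y \<and>
      u = m @ z \<and> v = y @ z)" for s
    by (cases s) (auto simp: pc_act_eq_Some)
  have e: "entry (iso_sum \<phi>) v u = (\<Sum>s\<in>?S. iso_sum \<phi> s :: 'k)"
    unfolding entry_def by (rule sum.mono_neutral_right) (auto simp: finite_pc_act)
  show ?thesis
  proof (cases "\<phi> u = Some v")
    case True
    then obtain m z where m: "m \<in> min_words (dom \<phi>)" "u = m @ z" using ex_min_word[of u "dom \<phi>"] by blast
    then obtain y where y: "\<phi> m = Some y" using min_words_sub by blast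
    have v: "v = y @ z" using right_ideal_isoD(1)[OF assms y, of z] True m by simp
    have "?S = {PC y m}"
    proof
      show "?S \<subseteq> {PC y m}"
      proof
        fix s assume "s \<in> ?S"
        then obtain m' y' z' where s: "s = PC y' m'" "m' \<in> min_words (dom \<phi>)" "\<phi> m' = Some y'"
          "u = m' @ z'" unfolding S by blast
        with min_words_comparable[OF m(1) s(2), of z z'] m y show "s \<in> {PC y m}" by simp
      qed
      show "{PC y m} \<subseteq> ?S" using m y v S[of "PC y m"] by blast
    qed
    then have "entry (iso_sum \<phi>) v u = (\<Sum>s\<in>{PC y m}. iso_sum \<phi> s :: 'k)" by (simp only: e)
    with True m(1) y show ?thesis by simp
  next
    case False
    have "s \<notin> ?S" for s
      unfolding S using False right_ideal_isoD(1)[OF assms] by blast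
    then have "?S = {}" by blast
    then have "entry (iso_sum \<phi>) v u = (\<Sum>s\<in>{}. iso_sum \<phi> s :: 'k)" by (simp only: e)
    with False show ?thesis by simp
  qed
qed

lemma reach_iso_sum:
  assumes "right_ideal_iso \<phi>"
  shows "reach (iso_sum \<phi> :: pc \<Rightarrow> 'k::field) u \<subseteq> {v. \<phi> u = Some v}"
proof
  fix v assume "v \<in> reach (iso_sum \<phi> :: pc \<Rightarrow> 'k) u"
  then obtain s where s: "(iso_sum \<phi> s :: 'k) \<noteq> 0" "pc_act s u = Some v" by (auto simp: reach_def)
  then obtain y m z where "s = PC y m" "u = m @ z" "v = y @ z" by (auto simp: pc_act_eq_Some)
  with s(1) right_ideal_isoD(1)[OF assms, of m y z] show "v \<in> {v. \<phi> u = Some v}"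
    by (auto split: if_splits)
qed

lemma iso_sum_closed:
  assumes "right_ideal_iso \<phi>"
  shows "iso_sum \<phi> \<in> carrier B_infty"
proof (rule carrier_B_reach)
  show "\<exists>A. finite A \<and> reach (iso_sum \<phi>) u \<subseteq> A" for u
    by (rule exI[of _ "{the (\<phi> u)}"]) (use reach_iso_sum[OF assms, of u] in auto)
  show "\<exists>A. finite A \<and> {u. v \<in> reach (iso_sum \<phi>) u} \<subseteq> A" for v
  proof (rule exI[of _ "{the (iso_inv \<phi> v)}"], safe)
    fix u assume "v \<in> reach (iso_sum \<phi>) u"
    then have "\<phi> u = Some v" using reach_iso_sum[OF assms] by blast
    then have "iso_inv \<phi> v = Some u" by (simp add: iso_inv_iff[OF assms])
    then show "u = the (iso_inv \<phi> v)" by simp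
  qed
qed simp

text \<open>Comparing entries avoids describing the prefix code that generates the domain of the
  composite.\<close>

lemma iso_sum_comp:
  assumes "right_ideal_iso \<phi>" "right_ideal_iso \<psi>"
  shows "pc_conv (iso_sum \<phi>) (iso_sum \<psi>) = iso_sum (\<phi> \<circ>\<^sub>m \<psi>)"
proof (rule entry_eqI)
  fix v u
  show "entry (pc_conv (iso_sum \<phi>) (iso_sum \<psi>)) v u = entry (iso_sum (\<phi> \<circ>\<^sub>m \<psi>)) v u"
  proof (cases "\<psi> u")
    case None
    with reach_iso_sum[OF assms(2), of u] show ?thesis
      by (subst entry_conv[OF iso_sum_closed[OF assms(2)], of "{}"])
        (auto simp: entry_iso_sum right_ideal_iso_comp assms)
  next
    case (Some w)
    with reach_iso_sum[OF assms(2), of u] show ?thesis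
      by (subst entry_conv[OF iso_sum_closed[OF assms(2)], of "{w}"])
        (auto simp: entry_iso_sum right_ideal_iso_comp assms)
  qed
qed (simp_all add: pc_conv_def)

lemma right_ideal_iso_pc_act: "right_ideal_iso (pc_act s)"
  by (rule right_ideal_isoI) (auto simp: pc_act_eq_Some)

text \<open>Single monoid elements become sums of isomorphisms, so \<open>iso_sum_comp\<close> also
  computes products with words and with inverse words.\<close>

lemma iso_sum_pc_act: "iso_sum (pc_act s) = (pc_single s :: pc \<Rightarrow> 'k::field)"
proof (rule entry_eqI)
  fix v u
  show "entry (iso_sum (pc_act s)) v u = entry (pc_single s :: pc \<Rightarrow> 'k) v u"
  proof (cases s)
    case PCZero
    then have "entry (pc_single s) v u = (0 :: 'k)"
      by (auto simp: entry_def pc_single_def intro!: sum.neutral)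
    then show ?thesis using PCZero by (simp add: entry_iso_sum right_ideal_iso_pc_act)
  next
    case (PC y x)
    then have "entry (pc_single s) v u = (\<Sum>t | pc_act t u = Some v. if t = s then 1 else (0 :: 'k))"
      unfolding entry_def by (intro sum.cong) (auto simp: pc_single_def)
    also have "\<dots> = (if pc_act s u = Some v then 1 else 0)"
      by (simp add: finite_pc_act)
    finally show ?thesis by (simp add: entry_iso_sum right_ideal_iso_pc_act)
  qed
qed (simp_all add: pc_single_def)

lemma pc_act_one: "pc_act (PC [] []) = Some"
  by (rule ext) simp

lemma iso_sum_Some: "iso_sum Some = pc_single (PC [] [])"
  using iso_sum_pc_act[of "PC [] []"] unfolding pc_act_one .

lemma iso_sum_empty: "iso_sum Map.empty = (\<lambda>p. 0)"
  by (rule ext) (simp add: iso_sum_def split: pc.splits)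

abbreviation word_single :: "word \<Rightarrow> pc \<Rightarrow> 'k::field" where
  "word_single w \<equiv> pc_single (PC w [])"

lemma word_single_append:
  "pc_conv (word_single u) (word_single v) = (word_single (u @ v) :: pc \<Rightarrow> 'k::field)"
  by (simp add: pc_conv_single inv_word_mult_def)

lemma iso_sum_word_single:
  assumes "right_ideal_iso \<phi>" "\<phi> u = Some v"
  shows "pc_conv (iso_sum \<phi>) (word_single u) = (word_single v :: pc \<Rightarrow> 'k::field)"
proof -
  have "\<phi> \<circ>\<^sub>m pc_act (PC u []) = pc_act (PC v [])"
    using right_ideal_isoD(1)[OF assms] by (auto simp: map_comp_def)
  then show ?thesis
    using iso_sum_comp[OF assms(1) right_ideal_iso_pc_act, where 'a = 'k] by (metis iso_sum_pc_act)
qed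

lemma iso_sum_word_single_zero:
  assumes "right_ideal_iso \<phi>" "\<And>z. \<phi> (u @ z) = None"
  shows "pc_conv (iso_sum \<phi>) (word_single u) = (\<lambda>p. 0 :: 'k::field)"
proof -
  have "\<phi> \<circ>\<^sub>m pc_act (PC u []) = Map.empty"
    using assms(2) by (auto simp: map_comp_def)
  then show ?thesis
    using iso_sum_comp[OF assms(1) right_ideal_iso_pc_act, where 'a = 'k]
    by (metis iso_sum_pc_act iso_sum_empty)
qed

lemma word_single_inject: "(word_single u :: pc \<Rightarrow> 'k::field) = word_single v \<Longrightarrow> u = v"
  by (drule fun_cong[of _ _ "PC u []"]) (auto simp: pc_single_def split: if_splits)

text \<open>The link between the indexed families of the definitions and isomorphisms: each minimal
  word of the domain is listed once, with its image. The index type is arbitrary, natural numbers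
  for the families of pairs and words for the codes \<open>Q i\<close>.\<close>

definition code_index :: "'i set \<Rightarrow> ('i \<Rightarrow> word) \<Rightarrow> ('i \<Rightarrow> word) \<Rightarrow> (word \<rightharpoonup> word) \<Rightarrow> bool" where
  "code_index I y x \<phi> \<longleftrightarrow> right_ideal_iso \<phi> \<and> inj_on x I \<and> x ` I = min_words (dom \<phi>) \<and>
     (\<forall>i\<in>I. \<phi> (x i) = Some (y i))"

lemma formal_sum_unique:
  assumes "\<And>i. i \<in> I \<Longrightarrow> g i p \<noteq> 0 \<Longrightarrow> i = k"
  shows "formal_sum I g p = (if k \<in> I then g k p else 0)"
proof -
  have "{i \<in> I. g i p \<noteq> 0} = (if k \<in> I \<and> g k p \<noteq> 0 then {k} else {})"
    using assms by auto
  then show ?thesis by (auto simp: formal_sum_def)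
qed

lemma formal_sum_zero: "(\<And>i. i \<in> I \<Longrightarrow> g i p = 0) \<Longrightarrow> formal_sum I g p = 0"
  by (auto simp: formal_sum_def intro!: sum.neutral)

lemma formal_sum_code_index:
  assumes "code_index I y x \<phi>"
  shows "formal_sum I (\<lambda>i. pc_single (PC (y i) (x i))) = (iso_sum \<phi> :: pc \<Rightarrow> 'k::field)"
proof
  fix p
  note c = assms[unfolded code_index_def]
  show "formal_sum I (\<lambda>i. pc_single (PC (y i) (x i))) p = (iso_sum \<phi> p :: 'k)"
  proof (cases "\<exists>k\<in>I. p = PC (y k) (x k)")
    case True
    then obtain k where k: "k \<in> I" "p = PC (y k) (x k)" by blast
    then have "x k \<in> min_words (dom \<phi>)" "\<phi> (x k) = Some (y k)" using c by auto
    then have "iso_sum \<phi> p = (1::'k)" using k by simp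
    moreover have "formal_sum I (\<lambda>i. pc_single (PC (y i) (x i))) p = (1::'k)"
      using c k by (subst formal_sum_unique[of _ _ _ k]) (auto simp: pc_single_def inj_on_def split: if_splits)
    ultimately show ?thesis by simp
  next
    case False
    have "iso_sum \<phi> p = (0::'k)"
    proof (rule ccontr)
      assume "iso_sum \<phi> p \<noteq> (0::'k)"
      then obtain y' x' where p: "p = PC y' x'" "x' \<in> x ` I" "\<phi> x' = Some y'"
        using c by (cases p) (auto split: if_splits)
      then obtain i where "i \<in> I" "x' = x i" by blast
      with c False p(1,3) show False by auto
    qed
    with False show ?thesis by (subst formal_sum_zero) (auto simp: pc_single_def)
  qed
qed

lemma ex_code_index:
  assumes "right_ideal_iso \<phi>"
  obtains I :: "nat set" and y x where "code_index I y x \<phi>"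
proof -
  obtain e :: "word \<Rightarrow> nat" where e: "inj e"
  proof
    \<comment> \<open>A word is coded by the list of truth values telling which of its letters are
      \<open>LetA\<close>; such lists are countable.\<close>
    show "inj (\<lambda>w :: word. to_nat (map ((=) LetA) w))"
    proof (rule injI)
      fix u v :: word
      assume "to_nat (map ((=) LetA) u) = to_nat (map ((=) LetA) v)"
      moreover have "inj ((=) LetA)" by (rule injI) (metis (full_types) letter.exhaust)
      ultimately show "u = v" by (auto dest: map_injective)
    qed
  qed
  define x where "x = inv_into UNIV e"
  have x: "x (e w) = w" for w using e by (simp add: x_def)
  have "code_index (e ` min_words (dom \<phi>)) (\<lambda>i. the (\<phi> (x i))) x \<phi>"
    unfolding code_index_def
  proof (intro conjI ballI)
    show "inj_on x (e ` min_words (dom \<phi>))" by (rule inj_onI) (auto simp: x)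
    show "x ` e ` min_words (dom \<phi>) = min_words (dom \<phi>)" by (simp add: image_image x)
    show "\<phi> (x i) = Some (the (\<phi> (x i)))" if "i \<in> e ` min_words (dom \<phi>)" for i
      using that min_words_sub by (auto simp: x) force
  qed (rule assms)
  then show ?thesis by (rule that)
qed

lemma prefix_code_min_words: "prefix_code (min_words R)"
  by (auto simp: min_words_def prefix_code_def)

lemma maximal_prefix_code_min_words: "essential R \<Longrightarrow> maximal_prefix_code (min_words R)"
  unfolding maximal_prefix_code_iff
  by (metis essential_meets ex_min_word prefixI prefix_code_min_words prefix_same_cases)

text \<open>Since \<phi> and its inverse commute with appending letters, \<phi> matches the minimal
  words of its domain with those of its range.\<close>

lemma code_index_images:
  assumes "code_index I y x \<phi>"
  shows "y ` I = min_words (ran \<phi>)" "inj_on y I"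
proof -
  note c = assms[unfolded code_index_def]
  have r: "right_ideal_iso \<phi>" using c by blast
  have min_ran: "v \<in> min_words (ran \<phi>) \<longleftrightarrow> u \<in> min_words (dom \<phi>)" if uv: "\<phi> u = Some v" for u v
  proof
    assume v: "v \<in> min_words (ran \<phi>)"
    obtain m z where m: "m \<in> min_words (dom \<phi>)" "u = m @ z" using uv ex_min_word[of u "dom \<phi>"] by blast
    then obtain v' where v': "\<phi> m = Some v'" using min_words_sub by blast
    with right_ideal_isoD(1)[OF r, of m v' z] uv m have "v = v' @ z" by simp
    with v v' have "v = v'" by (metis min_words_unique prefixI ranI)
    with \<open>v = v' @ z\<close> m show "u \<in> min_words (dom \<phi>)" by simp
  next
    assume u: "u \<in> min_words (dom \<phi>)"
    have "v \<in> ran \<phi>" using uv by (rule ranI)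
    then obtain n z where n: "n \<in> min_words (ran \<phi>)" "v = n @ z" using ex_min_word by metis
    then obtain m where m: "\<phi> m = Some n" using min_words_sub by (fastforce simp: ran_def)
    with right_ideal_isoD(1)[OF r m, of z] uv n have "u = m @ z"
      using right_ideal_isoD(2)[OF r] by simp
    with u m have "u = m" by (metis domI min_words_unique prefixI)
    with m uv n show "v \<in> min_words (ran \<phi>)" by simp
  qed
  show "y ` I = min_words (ran \<phi>)"
  proof
    show "y ` I \<subseteq> min_words (ran \<phi>)" using c min_ran by blast
    show "min_words (ran \<phi>) \<subseteq> y ` I"
    proof
      fix v assume v: "v \<in> min_words (ran \<phi>)"
      then obtain u where u: "\<phi> u = Some v" using min_words_sub by (fastforce simp: ran_def)
      with v min_ran c obtain i where "i \<in> I" "u = x i" by blast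
      with c u show "v \<in> y ` I" by auto
    qed
  qed
  show "inj_on y I"
    by (rule inj_onI) (use c right_ideal_isoD(2)[OF r] in \<open>metis inj_onD\<close>)
qed

text \<open>The isomorphism sends \<open>x i @ z\<close> to \<open>y i @ z\<close>; the prefix code
  hypotheses make it well defined and injective. Maximality appears as a premise of the last two
  conclusions, so the construction serves partial and full sums alike.\<close>

lemma code_index_prefix_codes:
  assumes "inj_on x I" "inj_on y I" "prefix_code (x ` I)" "prefix_code (y ` I)"
  obtains \<phi> where "code_index I y x \<phi>"
    "maximal_prefix_code (x ` I) \<Longrightarrow> essential (dom \<phi>)"
    "maximal_prefix_code (y ` I) \<Longrightarrow> essential (ran \<phi>)"
proof -
  define \<phi> where "\<phi> u = (if \<exists>i\<in>I. prefix (x i) u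
    then Some (let i = (SOME i. i \<in> I \<and> prefix (x i) u) in y i @ drop (length (x i)) u) else None)" for u
  have xD: "i = j \<and> z = z'" if "i \<in> I" "j \<in> I" "x i @ z = x j @ z'" for i j z z'
    using prefix_code_comparable[OF assms(3) _ _ that(3)] that assms(1) by (auto dest: inj_onD)
  have yD: "i = j \<and> z = z'" if "i \<in> I" "j \<in> I" "y i @ z = y j @ z'" for i j z z'
    using prefix_code_comparable[OF assms(4) _ _ that(3)] that assms(2) by (auto dest: inj_onD)
  have phi: "\<phi> u = Some v \<longleftrightarrow> (\<exists>i\<in>I. \<exists>z. u = x i @ z \<and> v = y i @ z)" for u v
  proof -
    have some: "(SOME i. i \<in> I \<and> prefix (x i) (x k @ z)) = k" if "k \<in> I" for k z
      using that xD by (intro some_equality) (auto simp: prefix_def)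
    have "\<phi> (x k @ z) = Some (y k @ z)" if "k \<in> I" for k z
    proof -
      have "\<exists>i\<in>I. prefix (x i) (x k @ z)" using that by (intro bexI[of _ k]) auto
      then show ?thesis using that by (simp add: \<phi>_def some)
    qed
    moreover have "\<exists>i\<in>I. \<exists>z. u = x i @ z" if "\<phi> u = Some v"
      using that by (auto simp: \<phi>_def prefix_def split: if_splits)
    ultimately show ?thesis by (metis option.inject)
  qed
  have r: "right_ideal_iso \<phi>"
  proof (rule right_ideal_isoI)
    show "\<phi> (u @ z) = Some (v @ z)" if "\<phi> u = Some v" for u v z
      using that unfolding phi by (metis append.assoc)
    show "u = u'" if "\<phi> u = Some v" "\<phi> u' = Some v" for u u' v
      using that yD unfolding phi by metis
  qed
  have dom: "u \<in> dom \<phi> \<longleftrightarrow> (\<exists>i\<in>I. \<exists>z. u = x i @ z)" for u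
    using phi by (auto simp del: domIff simp: dom_def)
  have ran: "v \<in> ran \<phi> \<longleftrightarrow> (\<exists>i\<in>I. \<exists>z. v = y i @ z)" for v
    using phi by (auto simp: ran_def)
  have "x ` I = min_words (dom \<phi>)"
  proof
    show "x ` I \<subseteq> min_words (dom \<phi>)"
    proof
      fix u assume "u \<in> x ` I"
      then obtain i where i: "i \<in> I" "u = x i" by blast
      then have "u \<in> dom \<phi>" unfolding dom by (metis append_Nil2)
      then obtain m z where m: "m \<in> min_words (dom \<phi>)" "u = m @ z" using ex_min_word by metis
      then obtain j z' where j: "j \<in> I" "m = x j @ z'" using min_words_sub dom by blast
      with m i xD[of i j "[]" "z' @ z"] have "z = []" by auto
      with m show "u \<in> min_words (dom \<phi>)" by simp
    qed
    show "min_words (dom \<phi>) \<subseteq> x ` I"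
    proof
      fix m assume m: "m \<in> min_words (dom \<phi>)"
      then obtain i z where i: "i \<in> I" "m = x i @ z" using min_words_sub dom by blast
      then have "x i \<in> dom \<phi>" unfolding dom by (metis append_Nil2)
      with m i have "m = x i" by (metis min_words_unique prefixI)
      with i show "m \<in> x ` I" by blast
    qed
  qed
  moreover have "\<phi> (x i) = Some (y i)" if "i \<in> I" for i
    using that unfolding phi by (metis append_Nil2)
  ultimately have "code_index I y x \<phi>" using r assms(1) by (simp add: code_index_def)
  moreover have "\<exists>z. \<exists>i\<in>I. \<exists>z'. w @ z = c i @ z'" if max: "maximal_prefix_code (c ` I)" for c w
  proof -
    obtain i where "i \<in> I" "prefix (c i) w \<or> prefix w (c i)"
      using max by (auto simp: maximal_prefix_code_iff)
    then show ?thesis by (metis append_Nil2 prefixE)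
  qed
  then have "maximal_prefix_code (x ` I) \<Longrightarrow> essential (dom \<phi>)"
    "maximal_prefix_code (y ` I) \<Longrightarrow> essential (ran \<phi>)"
    using right_ideal_iso_dom[OF r] right_ideal_iso_ran[OF r]
    by (simp_all only: essential_iff dom ran simp_thms)
  ultimately show ?thesis using that by blast
qed

section \<open>The sets \<open>U_infty_part\<close>, \<open>U_infty\<close> and \<open>U_V\<close>
  as sums of isomorphisms\<close>

lemma U_infty_part_eq: "U_infty_part = (iso_sum :: _ \<Rightarrow> pc \<Rightarrow> 'k::field) ` {\<phi>. right_ideal_iso \<phi>}"
proof (rule equalityI; rule subsetI)
  fix f :: "pc \<Rightarrow> 'k" assume "f \<in> U_infty_part"
  then obtain I :: "nat set" and y x where d: "f = formal_sum I (\<lambda>i. pc_single (PC (y i) (x i)))"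
    "inj_on x I" "inj_on y I" "prefix_code (x ` I)" "prefix_code (y ` I)"
    by (auto simp: U_infty_part_def)
  obtain \<phi> where "code_index I y x \<phi>" using code_index_prefix_codes[OF d(2-5)] by metis
  with d(1) show "f \<in> iso_sum ` {\<phi>. right_ideal_iso \<phi>}"
    by (auto simp: formal_sum_code_index) (simp add: code_index_def)
next
  fix f :: "pc \<Rightarrow> 'k" assume "f \<in> iso_sum ` {\<phi>. right_ideal_iso \<phi>}"
  then obtain \<phi> where f: "f = iso_sum \<phi>" "right_ideal_iso \<phi>" by blast
  obtain I :: "nat set" and y x where c: "code_index I y x \<phi>" using ex_code_index[OF f(2)] .
  with code_index_images[OF c] have "inj_on x I" "inj_on y I" "prefix_code (x ` I)" "prefix_code (y ` I)"
    by (auto simp: code_index_def prefix_code_min_words)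
  then show "f \<in> U_infty_part"
    unfolding U_infty_part_def f formal_sum_code_index[OF c, symmetric] by blast
qed

lemma maximal_prefix_codeD: "maximal_prefix_code P \<Longrightarrow> prefix_code P"
  by (simp add: maximal_prefix_code_def)

lemma code_index_ess_iso:
  assumes "inj_on x I" "inj_on y I" "maximal_prefix_code (x ` I)" "maximal_prefix_code (y ` I)"
  obtains \<phi> where "code_index I y x \<phi>" "ess_iso \<phi>"
proof -
  obtain \<phi> where "code_index I y x \<phi>" "essential (dom \<phi>)" "essential (ran \<phi>)"
    using code_index_prefix_codes[OF assms(1,2) assms(3,4)[THEN maximal_prefix_codeD]] assms(3,4)
    by blast
  then show ?thesis by (intro that[of \<phi>]) (auto simp: ess_iso_def code_index_def)
qed

lemma code_index_maximal:
  assumes "code_index I y x \<phi>" "ess_iso \<phi>"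
  shows "inj_on x I" "inj_on y I" "maximal_prefix_code (x ` I)" "maximal_prefix_code (y ` I)"
  using assms code_index_images[OF assms(1)]
  by (auto simp: code_index_def ess_iso_def maximal_prefix_code_min_words)

lemma U_infty_eq: "U_infty = (iso_sum :: _ \<Rightarrow> pc \<Rightarrow> 'k::field) ` {\<phi>. ess_iso \<phi>}"
proof (rule equalityI; rule subsetI)
  fix f :: "pc \<Rightarrow> 'k" assume "f \<in> U_infty"
  then obtain I :: "nat set" and y x where d: "f = formal_sum I (\<lambda>i. pc_single (PC (y i) (x i)))"
    "inj_on x I" "inj_on y I" "maximal_prefix_code (x ` I)" "maximal_prefix_code (y ` I)"
    by (auto simp: U_infty_def)
  obtain \<phi> where "code_index I y x \<phi>" "ess_iso \<phi>" using code_index_ess_iso[OF d(2-5)] .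
  with d(1) show "f \<in> iso_sum ` {\<phi>. ess_iso \<phi>}" by (auto simp: formal_sum_code_index)
next
  fix f :: "pc \<Rightarrow> 'k" assume "f \<in> iso_sum ` {\<phi>. ess_iso \<phi>}"
  then obtain \<phi> where f: "f = iso_sum \<phi>" "ess_iso \<phi>" by blast
  obtain I :: "nat set" and y x where c: "code_index I y x \<phi>" using ex_code_index[OF ess_isoD(1)[OF f(2)]] .
  show "f \<in> U_infty"
    unfolding U_infty_def f formal_sum_code_index[OF c, symmetric]
    using code_index_maximal[OF c f(2)] by blast
qed

lemma code_index_finite_iff:
  assumes "code_index I y x \<phi>"
  shows "finite I \<longleftrightarrow> fin_gen (dom \<phi>)" "finite I \<longleftrightarrow> fin_gen (ran \<phi>)"
proof -
  have "right_ideal_iso \<phi>" "inj_on x I" "x ` I = min_words (dom \<phi>)"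
    using assms by (auto simp: code_index_def)
  then show "finite I \<longleftrightarrow> fin_gen (dom \<phi>)" "finite I \<longleftrightarrow> fin_gen (ran \<phi>)"
    using code_index_images[OF assms] finite_image_iff[of x I] finite_image_iff[of y I]
    by (simp_all add: fin_gen_iff_min_words right_ideal_iso_dom right_ideal_iso_ran)
qed

lemma U_V_eq: "U_V = (iso_sum :: _ \<Rightarrow> pc \<Rightarrow> 'k::field) ` {\<phi>. fg_iso \<phi>}"
proof (rule equalityI; rule subsetI)
  fix f :: "pc \<Rightarrow> 'k" assume "f \<in> U_V"
  then obtain I :: "nat set" and y x where d: "f = formal_sum I (\<lambda>i. pc_single (PC (y i) (x i)))"
    "inj_on x I" "inj_on y I" "maximal_prefix_code (x ` I)" "maximal_prefix_code (y ` I)" "finite I"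
    by (auto simp: U_V_def)
  obtain \<phi> where c: "code_index I y x \<phi>" "ess_iso \<phi>" using code_index_ess_iso[OF d(2-5)] .
  with d(6) have "fg_iso \<phi>" unfolding fg_iso_def using code_index_finite_iff[OF c(1)] by blast
  with c d(1) show "f \<in> iso_sum ` {\<phi>. fg_iso \<phi>}" by (auto simp: formal_sum_code_index)
next
  fix f :: "pc \<Rightarrow> 'k" assume "f \<in> iso_sum ` {\<phi>. fg_iso \<phi>}"
  then obtain \<phi> where f: "f = iso_sum \<phi>" "ess_iso \<phi>" "fin_gen (dom \<phi>)" by (auto simp: fg_iso_def)
  obtain I :: "nat set" and y x where c: "code_index I y x \<phi>" using ex_code_index[OF ess_isoD(1)[OF f(2)]] .
  show "f \<in> U_V"
    unfolding U_V_def f formal_sum_code_index[OF c, symmetric]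
    using code_index_maximal[OF c f(2)] code_index_finite_iff[OF c] f(3) by blast
qed

section \<open>Elements vanishing on an essential right ideal\<close>

text \<open>Right multiplication by the word \<open>u\<close> restricts the matrix of \<open>f\<close> to the columns indexed by the
  right ideal \<open>u A\<^sup>*\<close>. Hence \<open>f \<in> near {0}\<close> says that the columns of \<open>f\<close> vanish on some essential
  right ideal; this is the invariant that separates distinct elements of the Thompson groups.\<close>

definition near :: "(pc \<Rightarrow> 'k::field) set \<Rightarrow> (pc \<Rightarrow> 'k) set" where
  "near T = {f \<in> carrier B_infty. \<forall>w. \<exists>z. pc_conv f (word_single (w @ z)) \<in> T}"

text \<open>These conditions make \<open>near T\<close> a linear space: stability under right
  multiplication by words lets an extension found for one element be lengthened to suit another. The
  two instances are the zero space and \<open>word_span\<close>.\<close>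

definition right_stable :: "(pc \<Rightarrow> 'k::field) set \<Rightarrow> bool" where
  "right_stable T \<longleftrightarrow> (\<lambda>p. 0) \<in> T \<and> (\<forall>f\<in>T. \<forall>g\<in>T. (\<lambda>p. f p + g p) \<in> T) \<and>
     (\<forall>c. \<forall>f\<in>T. pc_scale c f \<in> T) \<and> (\<forall>f\<in>T. \<forall>z. pc_conv f (word_single z) \<in> T)"

text \<open>Kept general for two uses: the span of the words, and the polycyclic algebra as the span
  of the single monoid elements. Adding one generator at a time gives the induction used for
  products.\<close>

inductive_set lin_span :: "(pc \<Rightarrow> 'k::field) set \<Rightarrow> (pc \<Rightarrow> 'k) set" for X where
  zero: "(\<lambda>p. 0) \<in> lin_span X"
| step: "f \<in> X \<Longrightarrow> h \<in> lin_span X \<Longrightarrow> (\<lambda>p. pc_scale c f p + h p) \<in> lin_span X"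

lemma pc_conv_zero [simp]: "pc_conv f (\<lambda>p. 0) = (\<lambda>p. 0)" "pc_conv (\<lambda>p. 0) f = (\<lambda>p. 0)"
  by (simp_all add: pc_conv_def fun_eq_iff)

lemma pc_scale_simps [simp]:
  "pc_scale c (\<lambda>p. 0) = (\<lambda>p. 0)" "pc_scale c (pc_scale d f) = pc_scale (c * d) f"
  "pc_scale 1 f = f"
  by (simp_all add: pc_scale_def mult.assoc)

lemma pc_scale_add: "pc_scale c (\<lambda>p. f p + g p) = (\<lambda>p. pc_scale c f p + pc_scale c g p)"
  by (simp add: pc_scale_def distrib_left)

lemma lin_span_carrier:
  assumes "X \<subseteq> carrier B_infty"
  shows "lin_span X \<subseteq> carrier B_infty"
proof
  show "h \<in> carrier B_infty" if "h \<in> lin_span X" for h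
    using that by induction (use assms in \<open>auto intro: B_zero_closed B_add_closed B_scale_closed\<close>)
qed

lemma lin_span_base: "f \<in> X \<Longrightarrow> f \<in> lin_span X"
  using lin_span.step[of f X "\<lambda>p. 0" 1] by (simp add: lin_span.zero)

lemma lin_span_add: "f \<in> lin_span X \<Longrightarrow> g \<in> lin_span X \<Longrightarrow> (\<lambda>p. f p + g p) \<in> lin_span X"
proof (induction rule: lin_span.induct)
  case (step f h c)
  from lin_span.step[OF step(1) step(3)[OF step(4)], of c] show ?case by (simp add: add.assoc)
qed simp

lemma lin_span_scale: "f \<in> lin_span X \<Longrightarrow> pc_scale c f \<in> lin_span X"
  by (induction rule: lin_span.induct) (auto simp: pc_scale_add intro: lin_span.intros)

lemma lin_span_conv:
  assumes X: "X \<subseteq> carrier B_infty" and Y: "Y \<subseteq> carrier B_infty"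
    and c: "\<And>x y. x \<in> X \<Longrightarrow> y \<in> Y \<Longrightarrow> pc_conv x y \<in> X"
    and f: "f \<in> lin_span X" and g: "g \<in> lin_span Y"
  shows "pc_conv f g \<in> lin_span X"
proof -
  have *: "pc_conv x g \<in> lin_span X" if "x \<in> X" for x
    using g
  proof induction
    case (step y h d)
    have "y \<in> carrier B_infty" "h \<in> carrier B_infty" using step lin_span_carrier[OF Y] Y by auto
    then have "pc_conv x (\<lambda>p. pc_scale d y p + h p) =
        (\<lambda>p. pc_scale d (pc_conv x y) p + pc_conv x h p)"
      by (simp add: pc_conv_add_right B_scale_closed pc_conv_scale_right)
    with step c[OF that] show ?case by (simp add: lin_span.step)
  qed (simp add: lin_span.zero)
  have g': "g \<in> carrier B_infty" using g lin_span_carrier[OF Y] by auto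
  from f show ?thesis
  proof induction
    case (step x h d)
    have "pc_conv (\<lambda>p. pc_scale d x p + h p) g =
        (\<lambda>p. pc_scale d (pc_conv x g) p + pc_conv h g p)"
      by (simp add: pc_conv_add_left g' pc_conv_scale_left)
    with step * show ?case by (simp add: lin_span_add lin_span_scale)
  qed (simp add: lin_span.zero)
qed

abbreviation word_span :: "(pc \<Rightarrow> 'k::field) set" where
  "word_span \<equiv> lin_span (range word_single)"

lemma right_stable_word_span: "right_stable word_span"
  unfolding right_stable_def
proof (intro conjI ballI allI)
  fix f :: "pc \<Rightarrow> 'a" and z assume f: "f \<in> word_span"
  show "pc_conv f (word_single z) \<in> word_span"
    by (rule lin_span_conv[where Y = "range word_single", OF _ _ _ f])
      (auto intro: B_single_closed lin_span_base simp: word_single_append)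
qed (auto intro: lin_span.zero lin_span_add lin_span_scale)

lemma right_stable_zero: "right_stable {\<lambda>p. 0}"
  by (simp add: right_stable_def)

lemma near_carrier: "f \<in> near T \<Longrightarrow> f \<in> carrier B_infty"
  by (simp add: near_def)

lemma near_extend:
  assumes "right_stable T" "f \<in> carrier B_infty" "pc_conv f (word_single w) \<in> T"
  shows "pc_conv f (word_single (w @ z)) \<in> T"
proof -
  have "pc_conv f (word_single (w @ z)) = pc_conv (pc_conv f (word_single w)) (word_single z)"
    by (simp add: pc_conv_assoc assms(2) B_single_closed word_single_append)
  then show ?thesis using assms by (simp add: right_stable_def)
qed

lemma near_zero: "right_stable T \<Longrightarrow> (\<lambda>p. 0) \<in> near T"
  by (simp add: near_def right_stable_def B_zero_closed)

lemma near_add: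
  assumes T: "right_stable T" and f: "f \<in> near T" and g: "g \<in> near T"
  shows "(\<lambda>p. f p + g p) \<in> near T"
proof -
  have fg: "f \<in> carrier B_infty" "g \<in> carrier B_infty" using f g by (auto simp: near_carrier)
  have "\<exists>z. pc_conv (\<lambda>p. f p + g p) (word_single (w @ z)) \<in> T" for w
  proof -
    obtain z where z: "pc_conv f (word_single (w @ z)) \<in> T" using f by (auto simp: near_def)
    obtain z' where z': "pc_conv g (word_single ((w @ z) @ z')) \<in> T" using g unfolding near_def by blast
    from near_extend[OF T fg(1) z, of z'] z' T show ?thesis
      by (intro exI[of _ "z @ z'"])
        (simp add: pc_conv_add_left B_single_closed right_stable_def)
  qed
  with fg show ?thesis by (simp add: near_def B_add_closed)
qed

lemma near_scale:
  assumes "right_stable T" "f \<in> near T"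
  shows "pc_scale c f \<in> near T"
  using assms
  by (fastforce simp: near_def B_scale_closed pc_conv_scale_left B_single_closed right_stable_def)

text \<open>Finiteness of the combination is what makes this work: each word of \<open>h\<close>
  requires its own extension, and the extensions are concatenated one word at a time.\<close>

lemma near_conv_word_span:
  assumes T: "right_stable T" and f: "f \<in> near T" and h: "h \<in> word_span"
  shows "\<exists>z. pc_conv f (pc_conv h (word_single z)) \<in> T"
  using h
proof induction
  case zero
  then show ?case using T by (simp add: right_stable_def)
next
  case (step g h c)
  have "h \<in> carrier B_infty"
    using step(2) lin_span_carrier[of "range word_single"] B_single_closed by blast
  then have B: "f \<in> carrier B_infty" "g \<in> carrier B_infty" "h \<in> carrier B_infty"
    using step(1) f by (auto simp: near_carrier B_single_closed)
  obtain y where y: "g = word_single y" using step by blast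
  obtain z where z: "pc_conv f (pc_conv h (word_single z)) \<in> T" using step by blast
  \<comment> \<open>The extension for the new word \<open>y\<close> is sought beyond
    \<open>z\<close>, so that what was achieved for \<open>h\<close> survives by stability of
    \<open>T\<close>.\<close>
  obtain z' where "pc_conv f (word_single ((y @ z) @ z')) \<in> T" using f unfolding near_def by blast
  then have 1: "pc_conv f (pc_conv g (word_single (z @ z'))) \<in> T" by (simp add: y word_single_append)
  have 2: "pc_conv f (pc_conv h (word_single (z @ z'))) =
      pc_conv (pc_conv f (pc_conv h (word_single z))) (word_single z')"
    by (simp add: pc_conv_assoc B B_single_closed B_conv_closed word_single_append)
  have "pc_conv f (pc_conv (\<lambda>p. pc_scale c g p + h p) (word_single (z @ z'))) =
      (\<lambda>p. pc_scale c (pc_conv f (pc_conv g (word_single (z @ z')))) p +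
        pc_conv f (pc_conv h (word_single (z @ z'))) p)"
    by (simp add: pc_conv_add_left pc_conv_add_right pc_conv_scale_left pc_conv_scale_right
        B B_single_closed B_conv_closed B_scale_closed)
  with 1 2 z T have "pc_conv f (pc_conv (\<lambda>p. pc_scale c g p + h p) (word_single (z @ z'))) \<in> T"
    by (simp add: right_stable_def)
  then show ?case by blast
qed

text \<open>For the zero space \<open>T\<close> this is closure of the vanishing elements under
  right multiplication; for \<open>T = word_span\<close> it is closure of
  \<open>near word_span\<close> under products.\<close>

lemma near_conv:
  assumes T: "right_stable T" and f: "f \<in> near T" and g: "g \<in> near word_span"
  shows "pc_conv f g \<in> near T"
proof -
  have B: "f \<in> carrier B_infty" "g \<in> carrier B_infty" using f g by (auto simp: near_carrier)
  have "\<exists>z. pc_conv (pc_conv f g) (word_single (w @ z)) \<in> T" for w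
  proof -
    obtain z where "pc_conv g (word_single (w @ z)) \<in> word_span" using g by (auto simp: near_def)
    from near_conv_word_span[OF T f this] obtain z'
      where "pc_conv f (pc_conv (pc_conv g (word_single (w @ z))) (word_single z')) \<in> T" by blast
    then have "pc_conv (pc_conv f g) (word_single (w @ z @ z')) \<in> T"
      by (simp add: pc_conv_assoc B B_single_closed B_conv_closed word_single_append)
    then show ?thesis by blast
  qed
  with B show ?thesis by (simp add: near_def B_conv_closed)
qed

lemma near_zero_conv_left:
  assumes "f \<in> near {\<lambda>p. 0}" "g \<in> carrier B_infty"
  shows "pc_conv g f \<in> near {\<lambda>p. 0}"
proof -
  have f: "f \<in> carrier B_infty" using assms(1) by (rule near_carrier)
  have "\<exists>z. pc_conv (pc_conv g f) (word_single (w @ z)) \<in> {\<lambda>p. 0}" for w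
  proof -
    obtain z where "pc_conv f (word_single (w @ z)) = (\<lambda>p. 0)"
      using assms(1) by (auto simp: near_def)
    then show ?thesis
      by (intro exI[of _ z]) (simp add: pc_conv_assoc assms(2) f B_single_closed)
  qed
  then show ?thesis using assms(2) f by (simp add: near_def B_conv_closed)
qed

section \<open>Sums of isomorphisms and essential right ideals of columns\<close>

lemma iso_sum_near_word_span:
  assumes "right_ideal_iso \<phi>"
  shows "(iso_sum \<phi> :: pc \<Rightarrow> 'k::field) \<in> near word_span"
proof -
  have "\<exists>z. pc_conv (iso_sum \<phi>) (word_single (w @ z)) \<in> (word_span :: (pc \<Rightarrow> 'k) set)" for w
  \<comment> \<open>Either some extension of \<open>w\<close> lies in the domain and is sent to a
    single word, or none does and the product is zero. The second case occurs for partial sums,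
    whose domains may fail to be essential.\<close>
  proof (cases "\<exists>z v. \<phi> (w @ z) = Some v")
    case True
    then obtain z v where "\<phi> (w @ z) = Some v" by blast
    from iso_sum_word_single[OF assms this, where 'k = 'k] show ?thesis
      by (intro exI[of _ z]) (simp add: lin_span_base)
  next
    case False
    then have "pc_conv (iso_sum \<phi>) (word_single (w @ [])) = (\<lambda>p. 0 :: 'k)"
      using iso_sum_word_single_zero[OF assms, of w, where 'k = 'k] by simp
    then show ?thesis
      by (intro exI[of _ "[]"]) (simp only: lin_span.zero)
  qed
  with assms show ?thesis by (simp add: near_def iso_sum_closed)
qed

lemma pc_conv_diff_left:
  assumes "h \<in> carrier B_infty"
  shows "pc_conv (\<lambda>p. f p - g p) h = (\<lambda>p. pc_conv f h p - pc_conv g h p)"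
  using pc_conv_add_left[OF assms, of f "pc_scale (-1) g"]
  by (simp add: pc_conv_scale_left assms) (simp add: pc_scale_def)

lemma pc_conv_diff_right:
  assumes "g \<in> carrier B_infty" "h \<in> carrier B_infty"
  shows "pc_conv f (\<lambda>p. g p - h p) = (\<lambda>p. pc_conv f g p - pc_conv f h p)"
  using pc_conv_add_right[OF assms(1) B_scale_closed[OF assms(2), of "-1"], of f]
  by (simp add: pc_conv_scale_right assms) (simp add: pc_scale_def)

lemma B_diff_closed:
  assumes "f \<in> carrier B_infty" "g \<in> carrier B_infty"
  shows "(\<lambda>p. f p - g p) \<in> carrier B_infty"
  using B_add_closed[OF assms(1) B_uminus_closed[OF assms(2)]] by simp

lemma iso_sum_diff_near_zero:
  assumes "ess_iso \<phi>" "right_ideal_iso \<psi>" "\<phi> \<subseteq>\<^sub>m \<psi>"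
  shows "(\<lambda>p. iso_sum \<phi> p - iso_sum \<psi> p :: 'k::field) \<in> near {\<lambda>p. 0}"
proof -
  have r: "right_ideal_iso \<phi>" using assms(1) by (rule ess_isoD)
  have "\<exists>z. pc_conv (\<lambda>p. iso_sum \<phi> p - iso_sum \<psi> p :: 'k) (word_single (w @ z)) = (\<lambda>p. 0)" for w
  proof -
    obtain z v where z: "\<phi> (w @ z) = Some v" using ess_isoD(2)[OF assms(1)] by blast
    then have "\<psi> (w @ z) = Some v" using assms(3) by (metis domI map_le_def)
    with z show ?thesis
      by (intro exI[of _ z])
        (simp add: pc_conv_diff_left B_single_closed iso_sum_word_single r assms(2))
  qed
  with r assms(2) show ?thesis by (simp add: near_def iso_sum_closed B_diff_closed)
qed

lemma maximal_iso_eq_if_diff_near_zero: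
  assumes "maximal_iso \<phi>" "maximal_iso \<psi>" "ess_iso \<phi>" "ess_iso \<psi>"
    and d: "(\<lambda>p. iso_sum \<phi> p - iso_sum \<psi> p :: 'k::field) \<in> near {\<lambda>p. 0}"
  shows "\<phi> = \<psi>"
proof (rule maximal_iso_eqI[OF assms(1-3)])
  fix w
  note r = ess_isoD(1)[OF assms(3)] ess_isoD(1)[OF assms(4)]
  let ?f = "\<lambda>p. iso_sum \<phi> p - iso_sum \<psi> p :: 'k"
  have f: "?f \<in> carrier B_infty" using d by (rule near_carrier)
  obtain z where z: "pc_conv ?f (word_single (w @ z)) \<in> {\<lambda>p. 0}" using d unfolding near_def by blast
  \<comment> \<open>The word is lengthened until both maps are defined on it. Vanishing survives by
    \<open>near_extend\<close>, and then the two image words must coincide.\<close>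
  obtain z1 v1 where 1: "\<phi> ((w @ z) @ z1) = Some v1" using ess_isoD(2)[OF assms(3)] by blast
  obtain z2 v2 where 2: "\<psi> (((w @ z) @ z1) @ z2) = Some v2" using ess_isoD(2)[OF assms(4)] by blast
  note 1 = right_ideal_isoD(1)[OF r(1) 1, of z2]
  have "pc_conv ?f (word_single ((w @ z) @ z1 @ z2)) \<in> {\<lambda>p. 0}"
    by (rule near_extend[OF right_stable_zero f z])
  then have "pc_conv (iso_sum \<phi>) (word_single (((w @ z) @ z1) @ z2)) =
      (pc_conv (iso_sum \<psi>) (word_single (((w @ z) @ z1) @ z2)) :: pc \<Rightarrow> 'k)"
    by (simp add: pc_conv_diff_left B_single_closed fun_eq_iff)
  then have "v1 @ z2 = v2"
    unfolding iso_sum_word_single[OF r(1) 1] iso_sum_word_single[OF r(2) 2]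
    by (rule word_single_inject)
  with 1 2 show "\<exists>z. \<phi> (w @ z) \<noteq> None \<and> \<phi> (w @ z) = \<psi> (w @ z)"
    by (intro exI[of _ "z @ z1 @ z2"]) simp
qed

section \<open>The two subalgebras\<close>

text \<open>Both algebras are \<open>B_infty\<close> with a smaller carrier, so their ideals and
  quotients can be treated uniformly in \<open>S\<close>.\<close>

abbreviation sub_B :: "(pc \<Rightarrow> 'k::field) set \<Rightarrow> (pc \<Rightarrow> 'k) ring" where
  "sub_B S \<equiv> B_infty\<lparr>carrier := S\<rparr>"

lemma ring_sub_B: "subring S B_infty \<Longrightarrow> ring (sub_B S)"
  using ring.subring_is_ring[OF ring_B_infty] .

lemma sub_B_a_inv:
  assumes "subring S B_infty" "f \<in> S"
  shows "\<ominus>\<^bsub>sub_B S\<^esub> f = (\<lambda>p. - f p)"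
proof -
  interpret ring "sub_B S" by (rule ring_sub_B[OF assms(1)])
  have "f \<in> carrier B_infty" using assms subringE(1) by blast
  then have "(\<lambda>p. - f p) \<in> S" using subringE(5)[OF assms] by (simp add: B_a_inv)
  then show ?thesis by (intro minus_equality) (use assms(2) in auto)
qed

lemma sub_B_minus:
  assumes "subring S B_infty" "g \<in> S"
  shows "f \<ominus>\<^bsub>sub_B S\<^esub> g = (\<lambda>p. f p - g p)"
  using sub_B_a_inv[OF assms] by (simp add: a_minus_def)

lemma subring_B_I:
  assumes "S \<subseteq> carrier B_infty" "pc_single (PC [] []) \<in> S" "\<And>c f. f \<in> S \<Longrightarrow> pc_scale c f \<in> S"
    and "\<And>f g. f \<in> S \<Longrightarrow> g \<in> S \<Longrightarrow> pc_conv f g \<in> S"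
    and "\<And>f g. f \<in> S \<Longrightarrow> g \<in> S \<Longrightarrow> (\<lambda>p. f p + g p) \<in> S"
  shows "subring S B_infty"
proof (rule ring.subringI[OF ring_B_infty])
  show "\<ominus>\<^bsub>B_infty\<^esub> f \<in> S" if "f \<in> S" for f
    using assms(1) assms(3)[OF that, of "-1"] that by (simp add: subset_iff B_a_inv pc_scale_def)
qed (use assms in auto)

lemma subring_near_word_span: "subring (near word_span) B_infty"
proof (rule subring_B_I)
  show "pc_single (PC [] []) \<in> near word_span"
    using iso_sum_near_word_span[OF right_ideal_iso_pc_act] by (metis iso_sum_pc_act)
qed (auto intro: near_carrier near_scale near_conv near_add right_stable_word_span)

text \<open>The inclusion of \<open>S\<close> in \<open>near word_span\<close> gives closure under
  right multiplication by elements of \<open>S\<close>; left multiplication is a matter of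
  associativity.\<close>

lemma ideal_near_zero:
  assumes S: "subring S B_infty" and "S \<subseteq> near word_span"
  shows "ideal (near {\<lambda>p. 0} \<inter> S) (sub_B S)"
proof (rule idealI[OF ring_sub_B[OF S]])
  interpret ring "sub_B S" by (rule ring_sub_B[OF S])
  have z: "(\<lambda>p. 0) \<in> S" using subringE(2)[OF S] by simp
  show "subgroup (near {\<lambda>p. 0} \<inter> S) (add_monoid (sub_B S))"
  proof (rule add.subgroupI)
    show "near {\<lambda>p. 0} \<inter> S \<noteq> {}" using z near_zero[OF right_stable_zero] by blast
    show "\<ominus>\<^bsub>sub_B S\<^esub> f \<in> near {\<lambda>p. 0} \<inter> S" if "f \<in> near {\<lambda>p. 0} \<inter> S" for f
    proof -
      have "\<ominus>\<^bsub>sub_B S\<^esub> f \<in> S" using that a_inv_closed[of f] by simp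
      moreover have "(\<lambda>p. - f p) \<in> near {\<lambda>p. 0}"
        using that near_scale[OF right_stable_zero, of f "-1"] by (simp add: pc_scale_def)
      ultimately show ?thesis using that by (simp add: sub_B_a_inv[OF S])
    qed
    show "f \<oplus>\<^bsub>sub_B S\<^esub> g \<in> near {\<lambda>p. 0} \<inter> S"
      if "f \<in> near {\<lambda>p. 0} \<inter> S" "g \<in> near {\<lambda>p. 0} \<inter> S" for f g
      using that a_closed[of f g] by (auto intro: near_add[OF right_stable_zero])
  qed auto
  fix f g assume fg: "f \<in> near {\<lambda>p. 0} \<inter> S" "g \<in> carrier (sub_B S)"
  then have "pc_conv g f \<in> S" "pc_conv f g \<in> S" using subringE(6)[OF S] by auto
  moreover have "pc_conv f g \<in> near {\<lambda>p. 0}" "pc_conv g f \<in> near {\<lambda>p. 0}"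
    using fg assms(2) subringE(1)[OF S]
    by (auto intro: near_conv[OF right_stable_zero] near_zero_conv_left)
  ultimately show "g \<otimes>\<^bsub>sub_B S\<^esub> f \<in> near {\<lambda>p. 0} \<inter> S" "f \<otimes>\<^bsub>sub_B S\<^esub> g \<in> near {\<lambda>p. 0} \<inter> S"
    by auto
qed

section \<open>The polycyclic algebra as a subring of \<open>B_infty\<close>\<close>

lemma lin_span_single_eq:
  "lin_span (range pc_single) = {f :: pc \<Rightarrow> 'k::field. f PCZero = 0 \<and> finite {p. f p \<noteq> 0}}"
proof (rule equalityI; rule subsetI)
  fix f :: "pc \<Rightarrow> 'k" assume "f \<in> lin_span (range pc_single)"
  then show "f \<in> {f. f PCZero = 0 \<and> finite {p. f p \<noteq> 0}}"
  proof induction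
    case (step f h c)
    have "{p. pc_scale c f p + h p \<noteq> 0} \<subseteq> {p. f p \<noteq> 0} \<union> {p. h p \<noteq> 0}"
      by (auto simp: pc_scale_def)
    moreover have "finite {p. f p \<noteq> 0}" using step by (auto simp: pc_single_def)
    ultimately have "finite {p. pc_scale c f p + h p \<noteq> 0}" using step by (auto intro: finite_subset)
    with step show ?case by (auto simp: pc_scale_def pc_single_def)
  qed simp
next
  have "f \<in> lin_span (range pc_single)" if "finite F" "f PCZero = 0" "{p. f p \<noteq> 0} \<subseteq> F" for F and f :: "pc \<Rightarrow> 'k"
    using that
  proof (induction F arbitrary: f rule: finite_induct)
    case empty
    then have "f = (\<lambda>p. 0)" by auto
    then show ?case by (simp add: lin_span.zero)
  next
    case (insert q F)
    have "f(q := 0) \<in> lin_span (range pc_single)" by (rule insert.IH) (use insert.prems in auto)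
    then have "(\<lambda>p. pc_scale (f q) (pc_single q) p + (f(q := 0)) p) \<in> lin_span (range pc_single)"
      by (rule lin_span.step[OF rangeI])
    moreover have "(\<lambda>p. pc_scale (f q) (pc_single q) p + (f(q := 0)) p) = f"
      using insert.prems(1) by (auto simp: fun_eq_iff pc_scale_def pc_single_def)
    ultimately show ?case by simp
  qed
  then show "f \<in> {f. f PCZero = 0 \<and> finite {p. f p \<noteq> 0}} \<Longrightarrow> f \<in> lin_span (range pc_single)"
    for f :: "pc \<Rightarrow> 'k"
    by blast
qed

lemma pc_algebra_eq: "pc_algebra = (sub_B (lin_span (range pc_single)) :: (pc \<Rightarrow> 'k::field) ring)"
  by (simp add: pc_algebra_def B_infty_def lin_span_single_eq)

lemma subring_pc_algebra: "subring (lin_span (range pc_single)) B_infty"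
proof (rule subring_B_I)
  show "lin_span (range pc_single) \<subseteq> carrier B_infty"
    by (rule lin_span_carrier) (auto intro: B_single_closed)
  show "pc_conv f g \<in> lin_span (range pc_single)"
    if "f \<in> lin_span (range pc_single)" "g \<in> lin_span (range pc_single)" for f g :: "pc \<Rightarrow> 'a"
    using that by (rule lin_span_conv[rotated 3]) (auto intro: B_single_closed simp: pc_conv_single)
qed (auto intro: lin_span_base lin_span_scale lin_span_add)

lemma single_near_word_span: "pc_single s \<in> near word_span"
  using iso_sum_near_word_span[OF right_ideal_iso_pc_act] by (metis iso_sum_pc_act)

lemma pc_algebra_near: "lin_span (range pc_single) \<subseteq> near word_span"
proof
  show "f \<in> near word_span" if "f \<in> lin_span (range pc_single)" for f
    using that by induction
      (auto intro!: near_add near_scale near_zero right_stable_word_span single_near_word_span)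
qed

section \<open>The algebra \<open>A_infty\<close>\<close>

definition A_carrier :: "(pc \<Rightarrow> 'k::field) set" where
  "A_carrier = \<Inter>{S. subring S B_infty \<and> (\<forall>c. \<forall>f\<in>S. pc_scale c f \<in> S) \<and> U_infty_part \<subseteq> S}"

lemma A_infty_eq: "A_infty = sub_B A_carrier"
  by (simp add: A_infty_def A_carrier_def)

text \<open>Provides both the inclusion of \<open>A_infty\<close> in \<open>near word_span\<close>
  and the non-emptiness of the family whose intersection is taken.\<close>

lemma near_word_span_generates:
  "near word_span \<in> {S. subring S B_infty \<and> (\<forall>c. \<forall>f\<in>S. pc_scale c f \<in> S) \<and> U_infty_part \<subseteq> S}"
  by (auto simp: subring_near_word_span U_infty_part_eq iso_sum_near_word_span
      intro: near_scale right_stable_word_span)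

lemma A_carrier_near: "A_carrier \<subseteq> near word_span"
  using near_word_span_generates unfolding A_carrier_def by blast

lemma subring_A_carrier: "subring A_carrier B_infty"
  unfolding A_carrier_def
  by (rule ring.subring_Inter[OF ring_B_infty]) (use near_word_span_generates in blast)+

lemma iso_sum_A_carrier: "right_ideal_iso \<phi> \<Longrightarrow> iso_sum \<phi> \<in> A_carrier"
  by (auto simp: A_carrier_def U_infty_part_eq)

section \<open>The two ideals\<close>

text \<open>A generator of the ideal \<open>I\<^sub>\<infinity>\<close> is the difference of the sums of an isomorphism \<open>\<psi>\<close>, with pairs
  \<open>(y\<^sub>i, x\<^sub>i)\<close>, and of its restriction \<open>\<phi>\<close> to the right ideal generated by all \<open>x\<^sub>i q\<close> with \<open>q \<in> Q\<^sub>i\<close>.\<close>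

lemma formal_sum_gen_eq:
  assumes c: "code_index I y x \<psi>" and phi: "right_ideal_iso \<phi>" "\<phi> \<subseteq>\<^sub>m \<psi>"
    and Q: "\<And>i. i \<in> I \<Longrightarrow> Q i = {q. x i @ q \<in> min_words (dom \<phi>)}"
  shows "formal_sum I (\<lambda>i. pc_single (PC (y i) []) \<otimes>\<^bsub>B_infty\<^esub>
          (formal_sum (Q i) (\<lambda>q. pc_single (PC q q)) \<ominus>\<^bsub>B_infty\<^esub> \<one>\<^bsub>B_infty\<^esub>)
          \<otimes>\<^bsub>B_infty\<^esub> pc_single (PC [] (x i))) =
    (\<lambda>p. iso_sum \<phi> p - iso_sum \<psi> p :: 'k::field)" (is "formal_sum I ?T = _")
proof
  have psi: "right_ideal_iso \<psi>" "inj_on x I" "x ` I = min_words (dom \<psi>)"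
    and y: "\<And>i. i \<in> I \<Longrightarrow> \<psi> (x i) = Some (y i)"
    using c by (auto simp: code_index_def)
  have x_min: "x i \<in> min_words (dom \<psi>)" if "i \<in> I" for i using psi(3) that by blast
  have ext: "\<psi> u = Some v" if "\<phi> u = Some v" for u v using that phi(2) by (metis domI map_le_def)
  \<comment> \<open>The summand at \<open>i\<close> is the part of \<phi> on extensions of
    \<open>x i\<close>, minus the single term of \<psi> there.\<close>
  have T: "?T i = (\<lambda>p. iso_sum (\<phi> |` {x i @ z | z. True}) p - pc_single (PC (y i) (x i)) p)"
    if i: "i \<in> I" for i
  proof -
    \<comment> \<open>The inner sum over \<open>Q i\<close> belongs to the identity restricted to
      the words \<open>u\<close> with \<open>x i @ u\<close> in \<open>dom \<phi>\<close>.
      Sandwiched between \<open>y i\<close> and the inverse of \<open>x i\<close>, it becomes a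
      restriction of \<phi>.\<close>
    define \<chi> where "\<chi> u = (if x i @ u \<in> dom \<phi> then Some u else None)" for u
    have chi: "right_ideal_iso \<chi>"
      by (rule right_ideal_isoI) (use right_ideal_append[OF right_ideal_iso_dom[OF phi(1)]] in
          \<open>auto simp: \<chi>_def simp flip: append_assoc simp del: domIff split: if_splits\<close>)
    have dom: "u \<in> dom \<chi> \<longleftrightarrow> x i @ u \<in> dom \<phi>" for u
      by (auto simp: \<chi>_def dom_def split: if_splits)
    have "min_words (dom \<chi>) = Q i"
    proof (rule Set.set_eqI)
      fix u
      \<comment> \<open>A word of \<open>dom \<phi>\<close> strictly below \<open>x i @ u\<close>
        cannot be a proper prefix of \<open>x i\<close>, which is minimal in the larger domain of
        \<psi>; hence it extends \<open>x i\<close>.\<close>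
      have up: "\<exists>v'. v = x i @ v' \<and> strict_prefix v' u"
        if v: "v \<in> dom \<phi>" "strict_prefix v (x i @ u)" for v
      proof -
        have "v \<in> dom \<psi>" using v(1) ext by auto
        then have "\<not> strict_prefix v (x i)" using x_min[OF i] by (auto simp: min_words_def)
        moreover have "prefix v (x i) \<or> prefix (x i) v"
          using v(2) by (meson prefixI prefix_same_cases strict_prefix_def)
        ultimately obtain v' where "v = x i @ v'" by (auto simp: strict_prefix_def prefix_def)
        with v(2) show ?thesis by (auto simp: strict_prefix_def)
      qed
      have down: "strict_prefix (x i @ v) (x i @ u)" if "strict_prefix v u" for v
        using that by (auto simp: strict_prefix_def)
      have "(\<forall>v\<in>dom \<chi>. \<not> strict_prefix v u) \<longleftrightarrow> (\<forall>v\<in>dom \<phi>. \<not> strict_prefix v (x i @ u))"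
      proof (intro iffI ballI notI)
        show False if "\<forall>v\<in>dom \<chi>. \<not> strict_prefix v u" "v \<in> dom \<phi>" "strict_prefix v (x i @ u)" for v
          using that(1) up[OF that(2,3)] that(2) dom by blast
        show False if "\<forall>v\<in>dom \<phi>. \<not> strict_prefix v (x i @ u)" "v \<in> dom \<chi>" "strict_prefix v u" for v
          using that(1,2) down[OF that(3)] dom by blast
      qed
      then show "u \<in> min_words (dom \<chi>) \<longleftrightarrow> u \<in> Q i"
        unfolding Q[OF i] min_words_def mem_Collect_eq using dom by blast
    qed
    moreover from this have "\<chi> q = Some q" if "q \<in> Q i" for q
      using that min_words_sub[of q "dom \<chi>"] dom[of q] by (simp add: \<chi>_def)
    ultimately have "code_index (Q i) (\<lambda>q. q) (\<lambda>q. q) \<chi>"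
      using chi by (simp add: code_index_def)
    then have fQ: "formal_sum (Q i) (\<lambda>q. pc_single (PC q q)) = (iso_sum \<chi> :: pc \<Rightarrow> 'k)"
      by (rule formal_sum_code_index)
    have comp: "(pc_act (PC (y i) []) \<circ>\<^sub>m \<chi>) \<circ>\<^sub>m pc_act (PC [] (x i)) = \<phi> |` {x i @ z | z. True}"
    proof
      fix u
      show "((pc_act (PC (y i) []) \<circ>\<^sub>m \<chi>) \<circ>\<^sub>m pc_act (PC [] (x i))) u = (\<phi> |` {x i @ z | z. True}) u"
      proof (cases "prefix (x i) u")
        case True
        then obtain z where u: "u = x i @ z" by (auto simp: prefix_def)
        show ?thesis
        proof (cases "\<phi> u")
          case (Some v)
          then have "v = y i @ z" using ext right_ideal_isoD(1)[OF psi(1) y[OF i], of z] u by fastforce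
          with Some u show ?thesis by (simp add: map_comp_def \<chi>_def domIff)
        qed (simp add: u map_comp_def \<chi>_def domIff)
      next
        case False
        then show ?thesis by (auto simp: map_comp_def restrict_map_def)
      qed
    qed
    have "?T i = pc_conv (pc_conv (word_single (y i))
        (\<lambda>p. iso_sum \<chi> p - pc_single (PC [] []) p)) (pc_single (PC [] (x i)))"
      by (simp add: a_minus_def B_a_inv B_single_closed fQ)
    also have "\<dots> = (\<lambda>p. pc_conv (pc_conv (word_single (y i)) (iso_sum \<chi>)) (pc_single (PC [] (x i))) p -
        pc_conv (pc_conv (word_single (y i)) (pc_single (PC [] []))) (pc_single (PC [] (x i))) p)"
      by (simp add: pc_conv_diff_left pc_conv_diff_right B_single_closed iso_sum_closed chi)
    also have "pc_conv (pc_conv (word_single (y i)) (pc_single (PC [] []))) (pc_single (PC [] (x i))) =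
        (pc_single (PC (y i) (x i)) :: pc \<Rightarrow> 'k)"
      by (simp add: pc_conv_single inv_word_mult_def split: list.splits)
    also have "pc_conv (pc_conv (word_single (y i)) (iso_sum \<chi>)) (pc_single (PC [] (x i))) =
        (iso_sum (\<phi> |` {x i @ z | z. True}) :: pc \<Rightarrow> 'k)"
      unfolding comp[symmetric] iso_sum_pc_act[symmetric]
      by (simp add: iso_sum_comp chi right_ideal_iso_pc_act right_ideal_iso_comp)
    finally show ?thesis .
  qed
  \<comment> \<open>Among the extensions of \<open>x i\<close>, restricting the domain does not
    change which words are minimal, again because no proper prefix of \<open>x i\<close> lies in
    \<open>dom \<psi>\<close>.\<close>
  have T': "?T i (PC v u) = (if prefix (x i) u then iso_sum \<phi> (PC v u) else 0) -
      (if u = x i \<and> v = y i then 1 else 0)" if i: "i \<in> I" for i v u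
  proof -
    have "u \<in> min_words (dom (\<phi> |` {x i @ z | z. True})) \<longleftrightarrow> u \<in> min_words (dom \<phi>)"
      if u: "prefix (x i) u"
    proof -
      have "\<exists>z. v = x i @ z" if v: "v \<in> dom \<phi>" "strict_prefix v u" for v
      proof -
        have "v \<in> dom \<psi>" using v(1) ext by auto
        then have "\<not> strict_prefix v (x i)" using x_min[OF i] by (auto simp: min_words_def)
        moreover have "prefix v (x i) \<or> prefix (x i) v"
          using v(2) u by (meson prefix_same_cases strict_prefix_def)
        ultimately show ?thesis by (auto simp: strict_prefix_def prefix_def)
      qed
      with u show ?thesis unfolding min_words_def by (auto simp: prefix_def)
    qed
    then show ?thesis
      unfolding T[OF i] by (auto simp: pc_single_def restrict_map_def prefix_def min_words_def split: if_splits)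
  qed
  fix p
  show "formal_sum I ?T p = iso_sum \<phi> p - iso_sum \<psi> p"
  proof (cases p)
    case PCZero
    then show ?thesis by (subst formal_sum_zero) (simp_all add: pc_conv_def)
  next
    case p: (PC v u)
    show ?thesis
    \<comment> \<open>As \<open>x\<close> enumerates a prefix code, at most one summand contributes
      to a given coefficient.\<close>
    proof (cases "\<exists>k\<in>I. prefix (x k) u")
      case True
      then obtain k where k: "k \<in> I" "prefix (x k) u" by blast
      have uniq: "i = k" if "i \<in> I" "prefix (x i) u" for i
        using k that psi(2) x_min min_words_comparable(1) unfolding prefix_def inj_on_def by metis
      have "?T i p = 0" if "i \<in> I" "i \<noteq> k" for i
        unfolding p T'[OF that(1)] using uniq that by auto
      then have "formal_sum I ?T p = (if k \<in> I then ?T k p else 0)"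
        by (intro formal_sum_unique) blast
      also have "\<dots> = ?T k p" using k(1) by (rule if_P)
      also have "\<dots> = iso_sum \<phi> p - (if u = x k \<and> v = y k then 1 else 0)"
        unfolding p by (simp only: T'[OF k(1)] k(2) if_True)
      also have "(if u = x k \<and> v = y k then 1 else 0) = (iso_sum \<psi> p :: 'k)"
      proof (cases "u = x k")
        case True
        then show ?thesis using x_min[OF k(1)] y[OF k(1)] unfolding p by auto
      next
        case False
        then have "u \<notin> min_words (dom \<psi>)"
          using k x_min[OF k(1)] by (metis min_words_sub min_words_unique)
        with False show ?thesis by (simp add: p)
      qed
      finally show ?thesis .
    next
      case False
      have "u \<notin> dom \<psi>"
      proof
        assume "u \<in> dom \<psi>"
        then obtain m z where "m \<in> min_words (dom \<psi>)" "u = m @ z" by (rule ex_min_word)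
        with False psi(3) show False by (metis imageE prefixI)
      qed
      then have "iso_sum \<phi> p = (0::'k)" "iso_sum \<psi> p = (0::'k)"
        using ext by (auto simp: p)
      moreover have "?T i p = 0" if "i \<in> I" for i
        unfolding p T'[OF that] using False that by auto
      ultimately show ?thesis by (subst formal_sum_zero) simp_all
    qed
  qed
qed

text \<open>In one direction \<open>D\<close> collects all words \<open>x i @ q @ z\<close>; in the
  other, \<open>Q i\<close> is read off from the prefix code of \<open>dom \<phi>\<close>.
  Maximality of the codes \<open>Q i\<close> corresponds to \<open>D\<close>, respectively
  \<open>dom \<phi>\<close>, being essential.\<close>

lemma I_infty_gens_eq: "I_infty_gens = {\<lambda>p. iso_sum \<phi> p - iso_sum \<psi> p :: 'k::field | \<phi> \<psi>.
    ess_iso \<phi> \<and> ess_iso \<psi> \<and> \<phi> \<subseteq>\<^sub>m \<psi>}"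
proof (rule equalityI; rule subsetI)
  fix f :: "pc \<Rightarrow> 'k" assume "f \<in> I_infty_gens"
  then obtain I :: "nat set" and y x Q where f: "f = formal_sum I (\<lambda>i. pc_single (PC (y i) []) \<otimes>\<^bsub>B_infty\<^esub>
          (formal_sum (Q i) (\<lambda>q. pc_single (PC q q)) \<ominus>\<^bsub>B_infty\<^esub> \<one>\<^bsub>B_infty\<^esub>)
          \<otimes>\<^bsub>B_infty\<^esub> pc_single (PC [] (x i)))"
    and d: "inj_on x I" "inj_on y I" "maximal_prefix_code (x ` I)" "maximal_prefix_code (y ` I)"
    and Q: "\<And>i. i \<in> I \<Longrightarrow> maximal_prefix_code (Q i)"
    unfolding I_infty_gens_def by blast
  obtain \<psi> where c: "code_index I y x \<psi>" and e: "ess_iso \<psi>" using code_index_ess_iso[OF d] .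
  have psi: "right_ideal_iso \<psi>" "x ` I = min_words (dom \<psi>)" using c by (auto simp: code_index_def)
  define D where "D = {x i @ q @ z | i q z. i \<in> I \<and> q \<in> Q i}"
  have DI: "x i @ q @ z \<in> D" if "i \<in> I" "q \<in> Q i" for i q z using that by (auto simp: D_def)
  have xD: "i = j \<and> z = z'" if "i \<in> I" "j \<in> I" "x i @ z = x j @ z'" for i j z z'
    using prefix_code_comparable[OF maximal_prefix_codeD[OF d(3)] _ _ that(3)] that d(1)
    by (auto dest: inj_onD)
  have "right_ideal D" unfolding right_ideal_def D_def by (auto, metis)
  moreover have "\<exists>z. w @ z \<in> D" for w
  proof -
    obtain i where i: "i \<in> I" "prefix (x i) w \<or> prefix w (x i)"
      using d(3) by (auto simp: maximal_prefix_code_iff)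
    then obtain z t where z: "w @ z = x i @ t" by (metis append_Nil2 prefixE)
    obtain q where q: "q \<in> Q i" "prefix q t \<or> prefix t q"
      using Q[OF i(1)] by (auto simp: maximal_prefix_code_iff)
    then obtain t' s where "t @ t' = q @ s" by (metis append_Nil2 prefixE)
    then have "w @ z @ t' = x i @ q @ s" by (metis append.assoc z)
    with DI[OF i(1) q(1), of s] show ?thesis by metis
  qed
  ultimately have D: "essential D" by (simp add: essential_iff)
  have "D \<subseteq> dom \<psi>"
  proof
    fix u assume "u \<in> D"
    then obtain i q z where u: "u = x i @ q @ z" "i \<in> I" by (auto simp: D_def)
    then have "x i \<in> dom \<psi>" using psi(2) min_words_sub by blast
    then show "u \<in> dom \<psi>"
      unfolding u by (rule right_ideal_append[OF right_ideal_iso_dom[OF psi(1)]])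
  qed
  then have dom: "dom (\<psi> |` D) = D" by auto
  have "Q i = {q. x i @ q \<in> min_words (dom (\<psi> |` D))}" if i: "i \<in> I" for i
    unfolding dom
  proof (rule equalityI; rule subsetI)
    fix q assume q: "q \<in> Q i"
    have "x i @ q @ [] \<in> D" using i q by (rule DI)
    then obtain m s where m: "m \<in> min_words D" "x i @ q = m @ s" using ex_min_word by (metis append_Nil2)
    then obtain j q' z where j: "j \<in> I" "q' \<in> Q j" "m = x j @ q' @ z"
      using min_words_sub unfolding D_def by blast
    with m xD[of i j q "q' @ z @ s"] i have ij: "i = j" "q @ [] = q' @ z @ s" by auto
    with j q prefix_code_comparable(2)[OF maximal_prefix_codeD[OF Q[OF i]] q _ ij(2)] have "s = []" by auto
    with m show "q \<in> {q. x i @ q \<in> min_words D}" by simp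
  next
    fix q assume "q \<in> {q. x i @ q \<in> min_words D}"
    then have m: "x i @ q \<in> min_words D" by simp
    then obtain j q' z where j: "j \<in> I" "q' \<in> Q j" "x i @ q = x j @ q' @ z"
      using min_words_sub unfolding D_def by blast
    with xD[OF i j(1) j(3)] have ij: "i = j" "q = q' @ z" by auto
    with j DI[OF i, of q' "[]"] have "x i @ q = x i @ q'"
      by (intro min_words_unique[OF m]) auto
    with j ij show "q \<in> Q i" by simp
  qed
  moreover have "ess_iso (\<psi> |` D)" using e D by (rule ess_iso_restrict)
  moreover have le: "\<psi> |` D \<subseteq>\<^sub>m \<psi>" by (auto simp: map_le_def)
  ultimately have "f = (\<lambda>p. iso_sum (\<psi> |` D) p - iso_sum \<psi> p)"
    unfolding f by (intro formal_sum_gen_eq[OF c]) (auto dest: ess_isoD(1))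
  with e le \<open>ess_iso (\<psi> |` D)\<close> show "f \<in> {\<lambda>p. iso_sum \<phi> p - iso_sum \<psi> p | \<phi> \<psi>.
    ess_iso \<phi> \<and> ess_iso \<psi> \<and> \<phi> \<subseteq>\<^sub>m \<psi>}" by blast
next
  fix f :: "pc \<Rightarrow> 'k"
  assume "f \<in> {\<lambda>p. iso_sum \<phi> p - iso_sum \<psi> p | \<phi> \<psi>. ess_iso \<phi> \<and> ess_iso \<psi> \<and> \<phi> \<subseteq>\<^sub>m \<psi>}"
  then obtain \<phi> \<psi> where f: "f = (\<lambda>p. iso_sum \<phi> p - iso_sum \<psi> p)"
    and e: "ess_iso \<phi>" "ess_iso \<psi>" "\<phi> \<subseteq>\<^sub>m \<psi>" by blast
  obtain I :: "nat set" and y x where c: "code_index I y x \<psi>" using ex_code_index[OF ess_isoD(1)[OF e(2)]] .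
  define Q where "Q i = {q. x i @ q \<in> min_words (dom \<phi>)}" for i
  have "maximal_prefix_code (Q i)" if i: "i \<in> I" for i
    unfolding maximal_prefix_code_iff
  proof (intro conjI allI)
    show "prefix_code (Q i)"
      unfolding prefix_code_def
    proof (intro ballI notI)
      fix q q' assume "q \<in> Q i" "q' \<in> Q i" "strict_prefix q q'"
      then have "x i @ q \<in> min_words (dom \<phi>)" "x i @ q' \<in> min_words (dom \<phi>)"
        "strict_prefix (x i @ q) (x i @ q')"
        by (auto simp: Q_def strict_prefix_def)
      then show False using prefix_code_min_words[of "dom \<phi>"] unfolding prefix_code_def by blast
    qed
    fix w
    obtain z v where "\<phi> ((x i @ w) @ z) = Some v" using ess_isoD(2)[OF e(1)] by blast
    then obtain m s where m: "m \<in> min_words (dom \<phi>)" "(x i @ w) @ z = m @ s"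
      using ex_min_word[of _ "dom \<phi>"] by (metis domI)
    have "prefix m (x i) \<or> prefix (x i) m" using m(2) by (metis append.assoc prefixI prefix_same_cases)
    moreover have "m \<in> dom \<psi>" using m(1) e(3) min_words_sub[of m "dom \<phi>"] by (metis domD domI map_le_def)
    moreover have "x i \<in> min_words (dom \<psi>)" using c i by (auto simp: code_index_def)
    ultimately obtain q where q: "m = x i @ q" by (metis append_Nil2 min_words_unique prefixE)
    with m have "q \<in> Q i" "w @ z = q @ s" by (auto simp: Q_def)
    then show "\<exists>q\<in>Q i. prefix q w \<or> prefix w q" by (metis prefixI prefix_same_cases)
  qed
  moreover have "f = formal_sum I (\<lambda>i. pc_single (PC (y i) []) \<otimes>\<^bsub>B_infty\<^esub>
          (formal_sum (Q i) (\<lambda>q. pc_single (PC q q)) \<ominus>\<^bsub>B_infty\<^esub> \<one>\<^bsub>B_infty\<^esub>)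
          \<otimes>\<^bsub>B_infty\<^esub> pc_single (PC [] (x i)))"
    unfolding f by (rule formal_sum_gen_eq[OF c ess_isoD(1)[OF e(1)] e(3) Q_def, symmetric])
  ultimately show "f \<in> I_infty_gens"
    unfolding I_infty_gens_def using code_index_maximal[OF c e(2)] by blast
qed

lemma I_infty_gens_near_zero: "I_infty_gens \<subseteq> near {\<lambda>p. 0} \<inter> A_carrier"
proof
  fix f :: "pc \<Rightarrow> 'a" assume "f \<in> I_infty_gens"
  then obtain \<phi> \<psi> where f: "f = (\<lambda>p. iso_sum \<phi> p - iso_sum \<psi> p)" and e: "ess_iso \<phi>" "ess_iso \<psi>" "\<phi> \<subseteq>\<^sub>m \<psi>"
    unfolding I_infty_gens_eq by blast
  interpret ring "sub_B (A_carrier :: (pc \<Rightarrow> 'a) set)" by (rule ring_sub_B[OF subring_A_carrier])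
  have S: "iso_sum \<phi> \<in> A_carrier" "iso_sum \<psi> \<in> A_carrier"
    using e by (auto intro: iso_sum_A_carrier ess_isoD(1))
  then have "f \<in> A_carrier"
    unfolding f sub_B_minus[OF subring_A_carrier S(2), symmetric]
    using minus_closed[of "iso_sum \<phi>" "iso_sum \<psi>"] by simp
  then show "f \<in> near {\<lambda>p. 0} \<inter> A_carrier"
    using iso_sum_diff_near_zero[OF e(1) ess_isoD(1)[OF e(2)] e(3)] by (simp add: f)
qed

lemma
  shows ideal_I_infty: "ideal I_infty (sub_B (A_carrier :: (pc \<Rightarrow> 'k::field) set))"
    and I_infty_gens_sub: "I_infty_gens \<subseteq> (I_infty :: (pc \<Rightarrow> 'k) set)"
    and I_infty_near_zero: "I_infty \<subseteq> (near {\<lambda>p. 0} :: (pc \<Rightarrow> 'k) set)"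
proof -
  interpret ring "sub_B (A_carrier :: (pc \<Rightarrow> 'k) set)" by (rule ring_sub_B[OF subring_A_carrier])
  have g: "I_infty_gens \<subseteq> carrier (sub_B (A_carrier :: (pc \<Rightarrow> 'k) set))"
    using I_infty_gens_near_zero by auto
  show "ideal I_infty (sub_B (A_carrier :: (pc \<Rightarrow> 'k) set))"
    unfolding I_infty_def A_infty_eq by (rule genideal_ideal[OF g])
  show "I_infty_gens \<subseteq> (I_infty :: (pc \<Rightarrow> 'k) set)"
    unfolding I_infty_def A_infty_eq by (rule genideal_self[OF g])
  show "I_infty \<subseteq> (near {\<lambda>p. 0} :: (pc \<Rightarrow> 'k) set)"
    unfolding I_infty_def A_infty_eq
    using genideal_minimal[OF ideal_near_zero[OF subring_A_carrier A_carrier_near] I_infty_gens_near_zero]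
    by blast
qed

section \<open>The ideal \<open>I_V\<close>\<close>

definition V_gen :: "pc \<Rightarrow> 'k::field" where
  "V_gen p = (pc_single (PC [LetA] [LetA]) p + pc_single (PC [LetB] [LetB]) p) - pc_single (PC [] []) p"

text \<open>On a non-empty word one of the two idempotents acts as the identity and the other as
  zero, so the generator kills every non-empty word.\<close>

lemma V_gen_near_zero: "V_gen \<in> near {\<lambda>p. 0 :: 'k::field}"
proof -
  have "\<exists>z. pc_conv V_gen (word_single (w @ z)) = (\<lambda>p. 0 :: 'k)" for w
  \<comment> \<open>The appended letter only guarantees that the word is not empty.\<close>
  proof (rule exI[of _ "[LetA]"])
    have "w @ [LetA] \<noteq> []" by simp
    then obtain l u where lu: "w @ [LetA] = l # u" by (cases "w @ [LetA]") auto
    show "pc_conv V_gen (word_single (w @ [LetA])) = (\<lambda>p. 0 :: 'k)"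
      unfolding lu V_gen_def
      by (cases l) (simp_all add: pc_conv_diff_left pc_conv_add_left B_single_closed pc_conv_single
          inv_word_mult_def, simp_all add: pc_single_def fun_eq_iff)
  qed
  then show ?thesis
    unfolding near_def V_gen_def by (auto intro!: B_diff_closed B_add_closed B_single_closed)
qed

lemma I_V_eq: "I_V = Idl\<^bsub>sub_B (lin_span (range pc_single))\<^esub> {V_gen :: pc \<Rightarrow> 'k::field}"
proof -
  have "pc_single (PC [] []) \<in> (lin_span (range pc_single) :: (pc \<Rightarrow> 'k) set)"
    by (intro lin_span_base rangeI)
  from sub_B_minus[OF subring_pc_algebra this] show ?thesis
    unfolding I_V_def pc_algebra_eq by (simp add: V_gen_def[abs_def])
qed

lemma V_gen_closed: "V_gen \<in> lin_span (range pc_single)"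
proof -
  have "(\<lambda>p. (pc_single (PC [LetA] [LetA]) p + pc_single (PC [LetB] [LetB]) p) +
      pc_scale (-1) (pc_single (PC [] [])) p) \<in> lin_span (range pc_single)"
    by (intro lin_span_add lin_span_scale lin_span_base rangeI)
  then show ?thesis by (simp add: pc_scale_def V_gen_def[abs_def])
qed

lemma
  shows ideal_I_V: "ideal I_V (sub_B (lin_span (range pc_single) :: (pc \<Rightarrow> 'k::field) set))"
    and V_gen_I_V: "V_gen \<in> (I_V :: (pc \<Rightarrow> 'k) set)"
    and I_V_near_zero: "I_V \<subseteq> (near {\<lambda>p. 0} :: (pc \<Rightarrow> 'k) set)"
proof -
  interpret ring "sub_B (lin_span (range pc_single) :: (pc \<Rightarrow> 'k) set)"
    by (rule ring_sub_B[OF subring_pc_algebra])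
  have g: "{V_gen} \<subseteq> carrier (sub_B (lin_span (range pc_single) :: (pc \<Rightarrow> 'k) set))"
    using V_gen_closed by simp
  show "ideal I_V (sub_B (lin_span (range pc_single) :: (pc \<Rightarrow> 'k) set))"
    unfolding I_V_eq by (rule genideal_ideal[OF g])
  show "V_gen \<in> (I_V :: (pc \<Rightarrow> 'k) set)"
    unfolding I_V_eq using genideal_self[OF g] by blast
  have "{V_gen} \<subseteq> near {\<lambda>p. 0} \<inter> lin_span (range pc_single)"
    using V_gen_near_zero V_gen_closed by blast
  from genideal_minimal[OF ideal_near_zero[OF subring_pc_algebra pc_algebra_near] this]
  show "I_V \<subseteq> (near {\<lambda>p. 0} :: (pc \<Rightarrow> 'k) set)"
    unfolding I_V_eq by blast
qed

text \<open>Modulo \<open>I\<^sub>V\<close> the idempotent \<open>w w\<inverse>\<close> is the sum of \<open>w a (w a)\<inverse>\<close> and \<open>w b (w b)\<inverse>\<close>, so an element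
  is in \<open>I\<^sub>V\<close> as soon as its products with all \<open>w w\<inverse>\<close> for \<open>w\<close> of a fixed length are.\<close>

lemma I_V_refine:
  fixes f :: "pc \<Rightarrow> 'k::field"
  assumes f: "f \<in> lin_span (range pc_single)"
    and n: "\<And>w. length w = n \<Longrightarrow> pc_conv f (pc_single (PC w w)) \<in> I_V"
  shows "f \<in> I_V"
  using n
proof (induction n)
  let ?S = "lin_span (range pc_single) :: (pc \<Rightarrow> 'k) set"
  interpret ideal I_V "sub_B ?S" by (rule ideal_I_V)
  have B: "f \<in> carrier B_infty" using f subringE(1)[OF subring_pc_algebra] by blast
  have conv: "pc_conv g h \<in> I_V" "pc_conv h g \<in> I_V" if "g \<in> I_V" "h \<in> ?S" for g h
    using that I_l_closed[of g h] I_r_closed[of g h] by simp_all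
  {
    case 0
    interpret B: ring "B_infty :: (pc \<Rightarrow> 'k) ring" by (rule ring_B_infty)
    \<comment> \<open>The only word of length zero gives the unit \<open>PC [] []\<close>.\<close>
    show ?case using 0[of "[]"] B.r_one[OF B] by simp
  next
    case (Suc n)
    show ?case
    proof (rule Suc.IH)
      fix w :: word assume w: "length w = n"
      \<comment> \<open>Conjugating \<open>V_gen\<close> by \<open>w\<close> gives
        \<open>wa (wa)^-1 + wb (wb)^-1 - w w^-1\<close>, solved here for the last term.\<close>
      have e: "pc_single (PC w w) = (\<lambda>p. (pc_single (PC (w @ [LetA]) (w @ [LetA])) p +
          pc_single (PC (w @ [LetB]) (w @ [LetB])) p) -
          pc_conv (pc_conv (word_single w) V_gen) (pc_single (PC [] w)) p :: 'k)"
        unfolding V_gen_def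
        by (simp add: pc_conv_diff_left pc_conv_diff_right pc_conv_add_left pc_conv_add_right
            B_single_closed B_add_closed pc_conv_single inv_word_mult_def split: list.splits)
      have s: "pc_single q \<in> ?S" for q by (intro lin_span_base rangeI)
      have V: "pc_conv (pc_conv (word_single w) V_gen) (pc_single (PC [] w)) \<in> (I_V :: (pc \<Rightarrow> 'k) set)"
        by (rule conv(1)[OF conv(2)[OF V_gen_I_V s] s])
      then have VB: "pc_conv (pc_conv (word_single w) V_gen) (pc_single (PC [] w)) \<in>
          carrier (B_infty :: (pc \<Rightarrow> 'k) ring)"
        using I_V_near_zero near_carrier by blast
      have "pc_conv f (pc_single (PC w w)) = (\<lambda>p. (pc_conv f (pc_single (PC (w @ [LetA]) (w @ [LetA]))) p +
          pc_conv f (pc_single (PC (w @ [LetB]) (w @ [LetB]))) p) -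
          pc_conv f (pc_conv (pc_conv (word_single w) V_gen) (pc_single (PC [] w))) p)"
        unfolding e by (simp add: pc_conv_diff_right pc_conv_add_right B_single_closed B_add_closed VB)
      moreover have "pc_conv f (pc_conv (pc_conv (word_single w) V_gen) (pc_single (PC [] w))) \<in> I_V"
        using conv(2)[OF V f] .
      moreover have "pc_conv f (pc_single (PC (w @ [l]) (w @ [l]))) \<in> I_V" for l
        using w by (intro Suc.prems) simp
      moreover have "(\<lambda>p. g p + h p - k p) \<in> I_V" if "g \<in> I_V" "h \<in> I_V" "k \<in> I_V" for g h k :: "pc \<Rightarrow> 'k"
      proof -
        have "k \<in> ?S" using that(3) Icarr by simp
        then have "(g \<oplus>\<^bsub>sub_B ?S\<^esub> h) \<ominus>\<^bsub>sub_B ?S\<^esub> k = (\<lambda>p. g p + h p - k p)"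
          by (simp add: sub_B_minus[OF subring_pc_algebra])
        moreover have "(g \<oplus>\<^bsub>sub_B ?S\<^esub> h) \<ominus>\<^bsub>sub_B ?S\<^esub> k \<in> I_V"
          unfolding a_minus_def
          by (intro additive_subgroup.a_closed[OF is_additive_subgroup]
              additive_subgroup.a_inv_closed[OF is_additive_subgroup] that)
        ultimately show ?thesis by simp
      qed
      ultimately show "pc_conv f (pc_single (PC w w)) \<in> I_V" by simp
    qed
  }
qed

lemma iso_sum_pc_algebra: "fg_iso \<phi> \<Longrightarrow> iso_sum \<phi> \<in> lin_span (range pc_single)"
proof -
  assume \<phi>: "fg_iso \<phi>"
  have "finite (min_words (dom \<phi>))"
    using \<phi> fin_gen_iff_min_words right_ideal_iso_dom by (auto simp: fg_iso_def ess_iso_def)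
  moreover have "{p. iso_sum \<phi> p \<noteq> (0 :: 'a)} \<subseteq> (\<lambda>x. PC (the (\<phi> x)) x) ` min_words (dom \<phi>)"
  proof
    fix p assume "p \<in> {p. iso_sum \<phi> p \<noteq> (0 :: 'a)}"
    then show "p \<in> (\<lambda>x. PC (the (\<phi> x)) x) ` min_words (dom \<phi>)"
    proof (cases p)
      case (PC y x)
      with \<open>p \<in> _\<close> show ?thesis by (intro image_eqI[of _ _ x]) (auto split: if_splits)
    qed simp
  qed
  ultimately show "(iso_sum \<phi> :: pc \<Rightarrow> 'a) \<in> lin_span (range pc_single)"
    by (auto simp: lin_span_single_eq intro: finite_subset)
qed

text \<open>Finite generation of \<open>dom \<phi>\<close> supplies one length \<open>n\<close> that
  works for all words, as \<open>I_V_refine\<close> requires.\<close>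

lemma iso_sum_diff_I_V:
  assumes "fg_iso \<phi>" "\<phi> \<subseteq>\<^sub>m \<psi>" "right_ideal_iso \<psi>"
  shows "(\<lambda>p. iso_sum \<phi> p - iso_sum \<psi> p :: 'k::field) \<in> I_V"
proof -
  let ?S = "lin_span (range pc_single) :: (pc \<Rightarrow> 'k) set"
  interpret ideal I_V "sub_B ?S" by (rule ideal_I_V)
  have r: "right_ideal_iso \<phi>" using assms(1) by (simp add: fg_iso_def ess_iso_def)
  have S: "iso_sum \<phi> \<in> ?S" "iso_sum \<psi> \<in> ?S"
    using assms fg_iso_extension[OF assms] by (auto intro: iso_sum_pc_algebra)
  obtain n where n: "\<And>w. n \<le> length w \<Longrightarrow> \<exists>v. \<phi> w = Some v"
    using assms(1) by (auto simp: fg_iso_iff)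
  let ?f = "\<lambda>p. iso_sum \<phi> p - iso_sum \<psi> p :: 'k"
  have f: "?f \<in> ?S"
    using minus_closed[of "iso_sum \<phi>" "iso_sum \<psi>"] S by (simp add: sub_B_minus[OF subring_pc_algebra])
  then have B: "?f \<in> carrier B_infty" using subringE(1)[OF subring_pc_algebra] by blast
  show ?thesis
  proof (rule I_V_refine[OF f, of n])
    fix w :: word assume w: "length w = n"
    then obtain v where v: "\<phi> w = Some v" using n by blast
    then have "\<psi> w = Some v" using assms(2) by (metis domI map_le_def)
    with v have 0: "pc_conv ?f (word_single w) = (\<lambda>p. 0)"
      by (simp add: pc_conv_diff_left B_single_closed iso_sum_word_single r assms(3))
    have "pc_conv (word_single w) (pc_single (PC [] w)) = (pc_single (PC w w) :: pc \<Rightarrow> 'k)"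
      by (simp add: pc_conv_single inv_word_mult_def)
    then have "pc_conv ?f (pc_single (PC w w)) = pc_conv (pc_conv ?f (word_single w)) (pc_single (PC [] w))"
      by (simp add: pc_conv_assoc B B_single_closed)
    also have "\<dots> = (\<lambda>p. 0)" by (simp add: 0)
    finally show "pc_conv ?f (pc_single (PC w w)) \<in> I_V"
      using additive_subgroup.zero_closed[OF is_additive_subgroup] by simp
  qed
qed

section \<open>The groups as groups of units\<close>

text \<open>Every group law of \<open>G\<close> is checked after applying the injective
  \<open>h\<close>, where it is an identity in the monoid \<open>M\<close>. This avoids a direct
  proof of associativity for products formed with \<open>max_extension\<close>.\<close>

lemma group_from_injection_into_units:
  assumes M: "monoid M" and one: "\<one>\<^bsub>G\<^esub> \<in> carrier G"
    and closed: "\<And>x y. x \<in> carrier G \<Longrightarrow> y \<in> carrier G \<Longrightarrow> x \<otimes>\<^bsub>G\<^esub> y \<in> carrier G"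
    and h: "\<And>x. x \<in> carrier G \<Longrightarrow> h x \<in> carrier M" and inj: "inj_on h (carrier G)"
    and h_one: "h \<one>\<^bsub>G\<^esub> = \<one>\<^bsub>M\<^esub>"
    and h_mult: "\<And>x y. x \<in> carrier G \<Longrightarrow> y \<in> carrier G \<Longrightarrow> h (x \<otimes>\<^bsub>G\<^esub> y) = h x \<otimes>\<^bsub>M\<^esub> h y"
    and l_inv: "\<And>x. x \<in> carrier G \<Longrightarrow> \<exists>y\<in>carrier G. h y \<otimes>\<^bsub>M\<^esub> h x = \<one>\<^bsub>M\<^esub>"
  shows "group G" "subgroup (h ` carrier G) (units_of M)"
    "G \<cong> (units_of M)\<lparr>carrier := h ` carrier G\<rparr>"
proof -
  interpret M: monoid M by (rule M)
  have eqI: "x = y" if "h x = h y" "x \<in> carrier G" "y \<in> carrier G" for x y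
    using that inj by (auto dest: inj_onD)
  show G: "group G"
  proof (rule groupI)
    show "x \<otimes>\<^bsub>G\<^esub> y \<otimes>\<^bsub>G\<^esub> z = x \<otimes>\<^bsub>G\<^esub> (y \<otimes>\<^bsub>G\<^esub> z)"
      if "x \<in> carrier G" "y \<in> carrier G" "z \<in> carrier G" for x y z
      by (rule eqI) (use that in \<open>simp_all add: closed h h_mult M.m_assoc\<close>)
    show "\<one>\<^bsub>G\<^esub> \<otimes>\<^bsub>G\<^esub> x = x" if "x \<in> carrier G" for x
      by (rule eqI) (use that in \<open>simp_all add: one closed h h_mult h_one\<close>)
    show "\<exists>y\<in>carrier G. y \<otimes>\<^bsub>G\<^esub> x = \<one>\<^bsub>G\<^esub>" if x: "x \<in> carrier G" for x
    proof -
      obtain y where y: "y \<in> carrier G" "h y \<otimes>\<^bsub>M\<^esub> h x = \<one>\<^bsub>M\<^esub>" using l_inv[OF x] by blast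
      then have "y \<otimes>\<^bsub>G\<^esub> x = \<one>\<^bsub>G\<^esub>"
        using x by (intro eqI) (simp_all add: one closed h_mult h_one)
      with y show ?thesis by blast
    qed
  qed (simp_all add: one closed)
  interpret G: group G by (rule G)
  have units: "h x \<in> Units M" if x: "x \<in> carrier G" for x
  proof -
    have "h x \<otimes>\<^bsub>M\<^esub> h (inv\<^bsub>G\<^esub> x) = \<one>\<^bsub>M\<^esub>" "h (inv\<^bsub>G\<^esub> x) \<otimes>\<^bsub>M\<^esub> h x = \<one>\<^bsub>M\<^esub>"
      using x by (simp_all add: h_one flip: h_mult)
    then show ?thesis using x h by (auto simp: Units_def)
  qed
  have hom: "h \<in> hom G (units_of M)"
    by (rule homI) (simp_all add: units h_mult units_of_carrier units_of_mult)
  then interpret H: group_hom G "units_of M" h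
    by (simp add: group_hom_def group_hom_axioms_def G M.units_group)
  show "subgroup (h ` carrier G) (units_of M)" by (rule H.img_is_subgroup)
  have "h \<in> iso G ((units_of M)\<lparr>carrier := h ` carrier G\<rparr>)"
    using hom inj by (auto simp: iso_iff hom_def)
  then show "G \<cong> (units_of M)\<lparr>carrier := h ` carrier G\<rparr>" by (rule is_isoI)
qed

text \<open>The common ground of the two cases, with \<open>P\<close> being \<open>fg_iso\<close> or
  \<open>ess_iso\<close>. \<open>diff_in\<close> makes an isomorphism equal to its extensions modulo
  \<open>I\<close>, and \<open>near_zero\<close> keeps distinct maximal isomorphisms apart.\<close>

locale iso_quotient =
  fixes S I :: "(pc \<Rightarrow> 'k::field) set" and P :: "(word \<rightharpoonup> word) \<Rightarrow> bool"
  assumes subring: "subring S B_infty" and ideal: "ideal I (sub_B S)"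
    and near_zero: "I \<subseteq> near {\<lambda>p. 0}"
    and ess: "P \<phi> \<Longrightarrow> ess_iso \<phi>" and Some: "P Some"
    and comp: "P \<phi> \<Longrightarrow> P \<psi> \<Longrightarrow> P (\<phi> \<circ>\<^sub>m \<psi>)"
    and inverse: "P \<phi> \<Longrightarrow> P (iso_inv \<phi>)"
    and extension: "P \<phi> \<Longrightarrow> \<phi> \<subseteq>\<^sub>m \<psi> \<Longrightarrow> right_ideal_iso \<psi> \<Longrightarrow> P \<psi>"
    and iso_sum_in: "P \<phi> \<Longrightarrow> iso_sum \<phi> \<in> S"
    and diff_in: "P \<phi> \<Longrightarrow> \<phi> \<subseteq>\<^sub>m \<psi> \<Longrightarrow> right_ideal_iso \<psi> \<Longrightarrow>
      (\<lambda>p. iso_sum \<phi> p - iso_sum \<psi> p) \<in> I"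
begin

definition G :: "(word \<rightharpoonup> word) monoid" where
  "G = \<lparr>carrier = {\<phi>. maximal_iso \<phi> \<and> P \<phi>}, mult = (\<lambda>\<phi> \<psi>. max_extension (\<phi> \<circ>\<^sub>m \<psi>)), one = Some\<rparr>"

definition cl :: "(word \<rightharpoonup> word) \<Rightarrow> (pc \<Rightarrow> 'k) set" where
  "cl \<phi> = I +>\<^bsub>sub_B S\<^esub> iso_sum \<phi>"

lemma cl_eq_iff:
  assumes "P \<phi>" "P \<psi>"
  shows "cl \<phi> = cl \<psi> \<longleftrightarrow> (\<lambda>p. iso_sum \<phi> p - iso_sum \<psi> p) \<in> I"
  using ring.quotient_eq_iff_same_a_r_cos[OF ring_sub_B[OF subring] ideal, of "iso_sum \<phi>" "iso_sum \<psi>"]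
    iso_sum_in[OF assms(1)] iso_sum_in[OF assms(2)]
  by (simp add: cl_def sub_B_minus[OF subring])

lemma cl_extension: "P \<phi> \<Longrightarrow> \<phi> \<subseteq>\<^sub>m \<psi> \<Longrightarrow> right_ideal_iso \<psi> \<Longrightarrow> cl \<phi> = cl \<psi>"
  using cl_eq_iff diff_in extension by blast

lemma max_ext: "P \<phi> \<Longrightarrow> P (max_extension \<phi>)" "P \<phi> \<Longrightarrow> cl (max_extension \<phi>) = cl \<phi>"
  using max_extension[OF ess] extension cl_extension by metis+

lemma cl_comp:
  assumes "P \<phi>" "P \<psi>"
  shows "cl (\<phi> \<circ>\<^sub>m \<psi>) = cl \<phi> \<otimes>\<^bsub>sub_B S Quot I\<^esub> cl \<psi>"
proof -
  interpret ideal I "sub_B S" by (rule ideal)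
  have r: "right_ideal_iso \<phi>" "right_ideal_iso \<psi>" using assms ess ess_isoD(1) by blast+
  show ?thesis
    using rcoset_mult_add[of "iso_sum \<phi>" "iso_sum \<psi>"] iso_sum_in[OF assms(1)] iso_sum_in[OF assms(2)]
    by (simp add: cl_def FactRing_def iso_sum_comp[OF r])
qed

lemma quotient_group:
  shows "group G" "subgroup (cl ` {\<phi>. P \<phi>}) (units_of (sub_B S Quot I))"
    "G \<cong> (units_of (sub_B S Quot I))\<lparr>carrier := cl ` {\<phi>. P \<phi>}\<rparr>"
proof -
  interpret I: ideal I "sub_B S" by (rule ideal)
  have M: "monoid (sub_B S Quot I)"
    using I.quotient_is_ring by (simp add: ring_def)
  have one: "cl Some = \<one>\<^bsub>sub_B S Quot I\<^esub>"
    by (simp add: cl_def FactRing_def iso_sum_Some)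
  have cl: "cl \<phi> \<in> carrier (sub_B S Quot I)" if "P \<phi>" for \<phi>
    using iso_sum_in[OF that] by (auto simp: cl_def FactRing_def A_RCOSETS_def')
  have inj: "inj_on cl (carrier G)"
  proof (rule inj_onI)
    fix \<phi> \<psi> assume "\<phi> \<in> carrier G" "\<psi> \<in> carrier G" and e: "cl \<phi> = cl \<psi>"
    then have P: "maximal_iso \<phi>" "P \<phi>" "maximal_iso \<psi>" "P \<psi>" by (auto simp: G_def)
    then have "(\<lambda>p. iso_sum \<phi> p - iso_sum \<psi> p :: 'k) \<in> near {\<lambda>p. 0}"
      using e near_zero cl_eq_iff by blast
    with P show "\<phi> = \<psi>" using maximal_iso_eq_if_diff_near_zero ess by blast
  qed
  have l_inv: "\<exists>\<psi>\<in>carrier G. cl \<psi> \<otimes>\<^bsub>sub_B S Quot I\<^esub> cl \<phi> = \<one>\<^bsub>sub_B S Quot I\<^esub>" if "\<phi> \<in> carrier G" for \<phi>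
  proof
    have P: "P \<phi>" using that by (simp add: G_def)
    show "max_extension (iso_inv \<phi>) \<in> carrier G"
      using max_extension(3)[OF ess] max_ext inverse[OF P] by (simp add: G_def)
    \<comment> \<open>The composite is only a restriction of the identity, but an isomorphism and
      its extensions have the same class.\<close>
    have "cl (iso_inv \<phi> \<circ>\<^sub>m \<phi>) = cl Some"
      using P ess ess_isoD(1) Some by (intro cl_extension comp inverse iso_inv_comp_le) blast+
    then show "cl (max_extension (iso_inv \<phi>)) \<otimes>\<^bsub>sub_B S Quot I\<^esub> cl \<phi> = \<one>\<^bsub>sub_B S Quot I\<^esub>"
      by (simp add: max_ext inverse P one flip: cl_comp)
  qed
  have G1: "\<one>\<^bsub>G\<^esub> \<in> carrier G" by (simp add: G_def Some maximal_iso_Some)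
  have G2: "\<phi> \<otimes>\<^bsub>G\<^esub> \<psi> \<in> carrier G" if "\<phi> \<in> carrier G" "\<psi> \<in> carrier G" for \<phi> \<psi>
    using that max_extension(3)[OF ess] max_ext comp by (auto simp: G_def)
  have mult: "cl (\<phi> \<otimes>\<^bsub>G\<^esub> \<psi>) = cl \<phi> \<otimes>\<^bsub>sub_B S Quot I\<^esub> cl \<psi>" if "\<phi> \<in> carrier G" "\<psi> \<in> carrier G" for \<phi> \<psi>
    using that by (auto simp: G_def max_ext comp cl_comp)
  \<comment> \<open>Every class in the image is that of a maximal isomorphism, so passing from the
    carrier of \<open>G\<close> to all of \<open>P\<close> adds no new classes.\<close>
  have img: "cl ` {\<phi>. P \<phi>} = cl ` carrier G"
  proof
    show "cl ` carrier G \<subseteq> cl ` {\<phi>. P \<phi>}" by (auto simp: G_def)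
    show "cl ` {\<phi>. P \<phi>} \<subseteq> cl ` carrier G"
    proof
      fix c assume "c \<in> cl ` {\<phi>. P \<phi>}"
      then obtain \<phi> where "P \<phi>" "c = cl \<phi>" by blast
      then show "c \<in> cl ` carrier G"
        using max_extension(3)[OF ess] max_ext
        by (intro image_eqI[of _ _ "max_extension \<phi>"]) (auto simp: G_def)
    qed
  qed
  have cl': "cl \<phi> \<in> carrier (sub_B S Quot I)" if "\<phi> \<in> carrier G" for \<phi>
    using that cl by (simp add: G_def)
  have one': "cl \<one>\<^bsub>G\<^esub> = \<one>\<^bsub>sub_B S Quot I\<^esub>" by (simp add: G_def one)
  note * = group_from_injection_into_units[OF M G1 G2 cl' inj one' mult l_inv]
  show "group G" "subgroup (cl ` {\<phi>. P \<phi>}) (units_of (sub_B S Quot I))"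
    "G \<cong> (units_of (sub_B S Quot I))\<lparr>carrier := cl ` {\<phi>. P \<phi>}\<rparr>"
    unfolding img by (rule *; assumption)+
qed

end

interpretation V: iso_quotient "lin_span (range pc_single)" "I_V :: (pc \<Rightarrow> 'k::field) set" fg_iso
proof (rule iso_quotient.intro)
  show "ess_iso \<phi>" if "fg_iso \<phi>" for \<phi>
    using that by (simp add: fg_iso_def)
qed (fact subring_pc_algebra ideal_I_V I_V_near_zero fg_iso_Some fg_iso_comp fg_iso_inv
  fg_iso_extension iso_sum_pc_algebra iso_sum_diff_I_V)+

interpretation G21: iso_quotient A_carrier "I_infty :: (pc \<Rightarrow> 'k::field) set" ess_iso
proof (rule iso_quotient.intro)
  show "ess_iso Some" using fg_iso_Some by (simp add: fg_iso_def)
  show "iso_sum \<phi> \<in> A_carrier" if "ess_iso \<phi>" for \<phi>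
    using iso_sum_A_carrier[OF ess_isoD(1)[OF that]] .
  show "(\<lambda>p. iso_sum \<phi> p - iso_sum \<psi> p) \<in> I_infty"
    if "ess_iso \<phi>" "\<phi> \<subseteq>\<^sub>m \<psi>" "right_ideal_iso \<psi>" for \<phi> \<psi>
    using that ess_iso_extension[OF that] I_infty_gens_sub unfolding I_infty_gens_eq by blast
qed (fact subring_A_carrier ideal_I_infty I_infty_near_zero ess_iso_comp ess_iso_inv
  ess_iso_extension | assumption)+

theorem theorem7p2:
  shows "(group thompson_V \<and>
          subgroup U_V_mod_I_V (units_of (C_V :: (pc \<Rightarrow> 'k::field) set ring)) \<and>
          thompson_V \<cong> (units_of (C_V :: (pc \<Rightarrow> 'k::field) set ring))\<lparr>carrier := U_V_mod_I_V\<rparr>)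
       \<and> (group thompson_G21 \<and>
          subgroup U_infty_mod_I_infty (units_of (C_infty :: (pc \<Rightarrow> 'k::field) set ring)) \<and>
          thompson_G21 \<cong>
            (units_of (C_infty :: (pc \<Rightarrow> 'k::field) set ring))\<lparr>carrier := U_infty_mod_I_infty\<rparr>)"
proof -
  have V: "thompson_V = V.G"
    by (simp add: thompson_V_def V.G_def fg_iso_def ess_iso_def maximal_iso_def cong: conj_cong)
  have G21: "thompson_G21 = G21.G"
    by (simp add: thompson_G21_def G21.G_def ess_iso_def maximal_iso_def cong: conj_cong)
  have CV: "(C_V :: (pc \<Rightarrow> 'k) set ring) = sub_B (lin_span (range pc_single)) Quot I_V"
    by (simp add: C_V_def pc_algebra_eq)
  have CG: "(C_infty :: (pc \<Rightarrow> 'k) set ring) = sub_B A_carrier Quot I_infty"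
    by (simp add: C_infty_def A_infty_eq)
  have UV: "(U_V_mod_I_V :: (pc \<Rightarrow> 'k) set set) = V.cl ` {\<phi>. fg_iso \<phi>}"
    by (simp add: U_V_mod_I_V_def U_V_eq V.cl_def pc_algebra_eq image_image)
  have UG: "(U_infty_mod_I_infty :: (pc \<Rightarrow> 'k) set set) = G21.cl ` {\<phi>. ess_iso \<phi>}"
    by (simp add: U_infty_mod_I_infty_def U_infty_eq G21.cl_def A_infty_eq image_image)
  show ?thesis
    unfolding V G21 CV CG UV UG using V.quotient_group G21.quotient_group by blast
qed

end
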